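(* Let $X$ be a complex manifold with $\dim_{\mathbb{C}} X = n$, let $q \geq 1$ be an integer, and let $\Omega \subset X$ be a relatively compact $q$-complete domain with $n > q$. Then the boundary $\partial \Omega$ of $\Omega$ in $X$ is connected.
   Context: A domain is a non-empty connected open subset; it is relatively compact if its closure in $X$ is compact. A domain $\Omega \subset X$ in a complex manifold $X$ is called $q$-complete if there exists a $\mathcal{C}^2$-smooth exhaustion function $\varphi \colon \Omega \to [0,+\infty)$ that is $q$-convex, i.e. its Levi form (in local holomorphic coordinates, the Hermitian form with matrix $\left(\frac{\partial^2 \varphi}{\partial z_j \partial \overline{z}_k}\right)_{j,k}$) has at most $q-1$ negative or zero eigenvalues (counted with multiplicity) at each point of $\Omega$. An exhaustion function is one for which all sublevel sets $\{x \in \Omega : \varphi(x) \leq c\}$, $c \in \mathbb{R}$, are compact. No regularity of the boundary $\partial\Omega$ is assumed. *)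

theory Defs
  imports "HOL-Analysis.Analysis" "HOL-Computational_Algebra.Polynomial"
begin

section \<open>Complex manifolds\<close>

text \<open>Holomorphic maps in several variables (meant for open sets): complex differentiable,
  i.e. the real Frechet derivative is complex linear.\<close>

definition holomorphic_map_on ::
    "(complex^'n \<Rightarrow> complex^'m) \<Rightarrow> (complex^'n) set \<Rightarrow> bool" where
  "holomorphic_map_on F S \<longleftrightarrow>
     (\<forall>z\<in>S. \<exists>D. (F has_derivative D) (at z) \<and> (\<forall>c v. D (c *s v) = c *s D v))"

text \<open>A chart is its domain together with its coordinate map; the coordinate map is irrelevant
  outside the domain.\<close>

type_synonym ('a, 'n) chart = "'a set \<times> ('a \<Rightarrow> complex^'n)"

definition is_chart :: "'a topology \<Rightarrow> ('a, 'n::finite) chart \<Rightarrow> bool" where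
  "is_chart X = (\<lambda>(U, f). openin X U \<and> open (f ` U) \<and>
     homeomorphic_map (subtopology X U) (top_of_set (f ` U)) f)"

text \<open>The complex dimension is \<open>CARD('n)\<close>. The atlas need not be maximal, and the
  manifold need not be connected.\<close>

definition complex_manifold :: "'a topology \<Rightarrow> ('a, 'n::finite) chart set \<Rightarrow> bool" where
  "complex_manifold X \<A> \<longleftrightarrow>
     Hausdorff_space X \<and> second_countable X \<and>
     (\<forall>c\<in>\<A>. is_chart X c) \<and> (\<Union>(U, f)\<in>\<A>. U) = topspace X \<and>
     (\<forall>(U, f)\<in>\<A>. \<forall>(V, g)\<in>\<A>. holomorphic_map_on (g \<circ> inv_into U f) (f ` (U \<inter> V)))"

section \<open>Domains\<close>

definition domain_in :: "'a topology \<Rightarrow> 'a set \<Rightarrow> bool" where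
  "domain_in X \<Omega> \<longleftrightarrow> \<Omega> \<noteq> {} \<and> openin X \<Omega> \<and> connectedin X \<Omega>"

definition relatively_compact_in :: "'a topology \<Rightarrow> 'a set \<Rightarrow> bool" where
  "relatively_compact_in X \<Omega> \<longleftrightarrow> compactin X (X closure_of \<Omega>)"

section \<open>The Levi form\<close>

text \<open>Twice continuously differentiable on an open set.\<close>

definition C2_on :: "('v::real_normed_vector \<Rightarrow> real) \<Rightarrow> 'v set \<Rightarrow> bool" where
  "C2_on u S \<longleftrightarrow>
     (\<exists>(u' :: 'v \<Rightarrow> 'v \<Rightarrow>\<^sub>L real) (u'' :: 'v \<Rightarrow> 'v \<Rightarrow>\<^sub>L 'v \<Rightarrow>\<^sub>L real).
        (\<forall>x\<in>S. (u has_derivative blinfun_apply (u' x)) (at x)) \<and>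
        (\<forall>x\<in>S. (u' has_derivative blinfun_apply (u'' x)) (at x)) \<and>
        continuous_on S u'')"

text \<open>The Wirtinger derivatives
  \<open>\<partial>/\<partial>z\<^sub>j = (\<partial>/\<partial>x\<^sub>j - \<i> \<partial>/\<partial>y\<^sub>j) / 2\<close> and
  \<open>\<partial>/\<partial>\<bar>z\<^sub>k = (\<partial>/\<partial>x\<^sub>k + \<i> \<partial>/\<partial>y\<^sub>k) / 2\<close>, where
  \<open>z\<^sub>j = x\<^sub>j + \<i> y\<^sub>j\<close>.\<close>

definition d_z :: "'n \<Rightarrow> (complex^'n \<Rightarrow> complex) \<Rightarrow> complex^'n::finite \<Rightarrow> complex" where
  "d_z j u z = (frechet_derivative u (at z) (axis j 1)
     - \<i> * frechet_derivative u (at z) (axis j \<i>)) / 2"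

definition d_zbar :: "'n \<Rightarrow> (complex^'n \<Rightarrow> complex) \<Rightarrow> complex^'n::finite \<Rightarrow> complex" where
  "d_zbar k u z = (frechet_derivative u (at z) (axis k 1)
     + \<i> * frechet_derivative u (at z) (axis k \<i>)) / 2"

definition levi_matrix :: "(complex^'n \<Rightarrow> real) \<Rightarrow> complex^'n::finite \<Rightarrow> complex^'n^'n" where
  "levi_matrix u z = (\<chi> j k. d_z j (d_zbar k (\<lambda>w. complex_of_real (u w))) z)"

definition charpoly :: "complex^'n^'n::finite \<Rightarrow> complex poly" where
  "charpoly A = det (mat [:0, 1:] - map_matrix (\<lambda>a. [:a:]) A)"

text \<open>Eigenvalues are counted with multiplicity, as roots of the characteristic polynomial.
  The function is only meant for Hermitian matrices, whose eigenvalues are real, so that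
  \<open>Re\<close> loses nothing.\<close>

definition num_nonpos_eigenvalues :: "complex^'n^'n::finite \<Rightarrow> nat" where
  "num_nonpos_eigenvalues A = size {#l \<in># proots (charpoly A). Re l \<le> 0#}"

section \<open>\<open>q\<close>-complete domains\<close>

text \<open>In the following \<open>\<Omega>\<close> is open and \<open>\<phi>\<close> is a function on \<open>\<Omega>\<close>; its values outside
  \<open>\<Omega>\<close> are irrelevant. The expression \<open>\<phi> \<circ> inv_into U f\<close> is \<open>\<phi>\<close> in the coordinates
  of the chart \<open>(U, f)\<close>. \<open>C\<^sup>2\<close>-smoothness and the signature of the Levi form do not depend
  on the choice of coordinates.\<close>

definition C2_smooth_on ::
    "('a, 'n::finite) chart set \<Rightarrow> 'a set \<Rightarrow> ('a \<Rightarrow> real) \<Rightarrow> bool" where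
  "C2_smooth_on \<A> \<Omega> \<phi> \<longleftrightarrow> (\<forall>(U, f)\<in>\<A>. C2_on (\<phi> \<circ> inv_into U f) (f ` (U \<inter> \<Omega>)))"

definition q_convex_on ::
    "('a, 'n::finite) chart set \<Rightarrow> nat \<Rightarrow> 'a set \<Rightarrow> ('a \<Rightarrow> real) \<Rightarrow> bool" where
  "q_convex_on \<A> q \<Omega> \<phi> \<longleftrightarrow>
     (\<forall>(U, f)\<in>\<A>. \<forall>p\<in>U \<inter> \<Omega>.
        num_nonpos_eigenvalues (levi_matrix (\<phi> \<circ> inv_into U f) (f p)) \<le> q - 1)"

definition exhaustion_function :: "'a topology \<Rightarrow> 'a set \<Rightarrow> ('a \<Rightarrow> real) \<Rightarrow> bool" where
  "exhaustion_function X \<Omega> \<phi> \<longleftrightarrow> (\<forall>c. compactin X {x\<in>\<Omega>. \<phi> x \<le> c})"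

definition q_complete ::
    "'a topology \<Rightarrow> ('a, 'n::finite) chart set \<Rightarrow> nat \<Rightarrow> 'a set \<Rightarrow> bool" where
  "q_complete X \<A> q \<Omega> \<longleftrightarrow>
     (\<exists>\<phi>. (\<forall>x\<in>\<Omega>. 0 \<le> \<phi> x) \<and> C2_smooth_on \<A> \<Omega> \<phi> \<and>
          exhaustion_function X \<Omega> \<phi> \<and> q_convex_on \<A> q \<Omega> \<phi>)"

end

theory Submission
  imports Defs "HOL-Computational_Algebra.Fundamental_Theorem_Algebra"
begin

text \<open>At every point of \<open>\<Omega>\<close> the Levi form of the exhaustion function \<open>\<phi>\<close> has two positive
  eigenvalues, which forces the real Hessian to be positive definite on a real plane. Hence every
  \<open>p \<in> \<Omega>\<close> has small neighbourhoods in which \<open>{\<phi> > \<phi> p}\<close> is connected, whether or not \<open>p\<close> is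
  critical. It follows that a separation of \<open>{\<phi> > t}\<close> extends to one of \<open>{\<phi> > s}\<close> for some
  \<open>s < t\<close>; since \<open>\<Omega>\<close> is connected, so are all superlevel sets. If the boundary split into two
  closed parts, disjoint neighbourhoods of these would cover \<open>\<Omega>\<close> outside a compact subset of
  \<open>\<Omega>\<close> and so disconnect \<open>{\<phi> > c}\<close> for large \<open>c\<close>.\<close>

section \<open>Hermitian matrices with two positive eigenvalues\<close>

text \<open>Since \<open>q < CARD('n)\<close>, at most \<open>q - 1\<close> nonpositive Levi
  eigenvalues leave at least two positive ones. One would not do: in the complex plane
  \<open>3 * x^2 - y^2\<close> has positive Levi form, yet near the origin the set where it is
  positive falls into two pieces; and an annulus, 1-complete of dimension 1, has disconnected
  boundary. The second direction replaces the two ends of a segment by a circle. The obstacle is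
  that the Levi form sees only the sum of the real Hessian at \<open>x\<close> and at
  \<open>i x\<close>, so a plane on which the real Hessian itself is positive definite has to be
  extracted from it. Moreover \<open>\<phi>\<close> is merely twice continuously differentiable and
  its critical points may be degenerate, so no Morse normal form is at hand. All that is taken from
  the local analysis is that the part of a small neighbourhood above the level of its centre is
  connected and nonempty. Connectedness keeps a separation from running through a level set;
  nonemptiness, the absence of local maxima, keeps level points from being detached from both
  parts.\<close>

lemma poly_charpoly: "poly (charpoly A) x = det (mat x - A)"
proof -
  have "poly (mat [:0, 1:] $ i $ j - map_matrix (\<lambda>a. [:a:]) A $ i $ j) x = (mat x - A) $ i $ j" for i j
    by (simp add: mat_def map_matrix_def)
  then show ?thesis
    by (simp add: charpoly_def det_def poly_sum poly_prod)
qed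

text \<open>In the Leibniz expansion only the identity multiplies \<open>CARD('n)\<close> linear
  entries; any other permutation picks up a constant off-diagonal entry. The degree is what turns a
  bound on nonpositive roots into a count of positive ones.\<close>

lemma degree_charpoly:
  fixes A :: "complex^'n^'n"
  shows "degree (charpoly A) = CARD('n)"
proof -
  define B where "B = mat [:0, 1:] - map_matrix (\<lambda>a. [:a:]) A"
  have B: "B $ i $ j = (if i = j then [:- A $ i $ j, 1:] else [:- A $ i $ j:])" for i j
    by (simp add: B_def mat_def map_matrix_def)
  define t where "t p = of_int (sign p) * (\<Prod>i\<in>UNIV. B $ i $ p i)" for p :: "'n \<Rightarrow> 'n"
  have t_id: "degree (t id) = CARD('n)"
    by (simp add: t_def B degree_prod_sum_eq)
  have t_less: "degree (t p) < CARD('n)" if p: "p permutes UNIV" "p \<noteq> id" for p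
  proof -
    obtain i where i: "p i \<noteq> i"
      using p by (metis eq_id_iff)
    have "degree (of_int (sign p) :: complex poly) = 0"
      by simp
    then have "degree (t p) \<le> degree (\<Prod>i\<in>UNIV. B $ i $ p i)"
      unfolding t_def using degree_mult_le[of "of_int (sign p)" "\<Prod>i\<in>UNIV. B $ i $ p i"] by simp
    also have "\<dots> \<le> (\<Sum>i\<in>UNIV. degree (B $ i $ p i))"
      using degree_prod_sum_le[of UNIV "\<lambda>i. B $ i $ p i"] by (simp add: o_def)
    also have "\<dots> < (\<Sum>i\<in>(UNIV::'n set). 1)"
      by (rule sum_strict_mono_ex1) (use i in \<open>auto simp: B intro!: exI[of _ i]\<close>)
    finally show ?thesis by simp
  qed
  let ?S = "{p. p permutes (UNIV::'n set)}"
  have "charpoly A = t id + (\<Sum>p\<in>?S - {id}. t p)"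
    unfolding charpoly_def B_def[symmetric] det_def t_def[symmetric]
    by (subst sum.remove[of _ id]) (auto simp: permutes_id)
  moreover have "degree (\<Sum>p\<in>?S - {id}. t p) < CARD('n)"
    by (rule degree_sum_less) (auto intro: t_less)
  ultimately show ?thesis
    using t_id by (simp add: degree_add_eq_left)
qed

text \<open>The matrix determinant lemma. In a basis containing \<open>v\<close> the operator
  differs from the identity in a single row, so its determinant is one diagonal entry.\<close>

lemma det_rank_one_update:
  fixes v w :: "'a::field^'n"
  shows "det (mat 1 - (\<chi> i j. v $ i * w $ j)) = 1 - (\<Sum>i\<in>UNIV. w $ i * v $ i)"
proof (cases "v = 0")
  case True
  then have "mat 1 - (\<chi> i j. v $ i * w $ j) = mat 1"
    by (simp add: vec_eq_iff)
  with True show ?thesis by simp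
next
  case False
  then obtain k where k: "v $ k \<noteq> 0"
    by (auto simp: vec_eq_iff)
  \<comment> \<open>\<open>P\<close> is the change of basis that replaces the \<open>k\<close>-th
    unit vector by \<open>v\<close>, and \<open>R\<close> is the given operator in the new basis.
    Its row \<open>x\<close> is forced by the equation \<open>(mat 1 - v w) ** P = P ** R\<close>,
    and \<open>det P = v $ k\<close> can be cancelled.\<close>
  define P :: "'a^'n^'n" where "P = (\<chi> i j. if j = k then v $ i else mat 1 $ i $ j)"
  define x :: "'a^'n" where "x = (\<chi> j. (if j = k then 1 else 0) - (\<Sum>l\<in>UNIV. w $ l * P $ l $ j))"
  define R :: "'a^'n^'n" where "R = (\<chi> i. if i = k then x else row i (mat 1))"
  have detP: "det P = v $ k"
    using cramer_lemma[of k "mat 1" v, unfolded matrix_vector_mul_lid] by (simp add: P_def)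
  have "(\<Sum>i\<in>UNIV. x $ i *s row i (mat 1 :: 'a^'n^'n)) = x"
    by (simp add: vec_eq_iff row_def mat_def if_distrib[of "\<lambda>x. _ * x"] cong: if_cong)
  then have "det R = x $ k"
    using cramer_lemma_transpose[of k x "mat 1 :: 'a^'n^'n"] unfolding R_def by (simp only: det_I mult_1_right)
  also have "\<dots> = 1 - (\<Sum>i\<in>UNIV. w $ i * v $ i)"
    by (simp add: x_def P_def)
  finally have detR: "det R = 1 - (\<Sum>i\<in>UNIV. w $ i * v $ i)" .
  have "((mat 1 - (\<chi> i j. v $ i * w $ j)) ** P) $ i $ j = (P ** R) $ i $ j" for i j
  proof -
    have "((mat 1 - (\<chi> i j. v $ i * w $ j)) ** P) $ i $ j =
        P $ i $ j - v $ i * (\<Sum>l\<in>UNIV. w $ l * P $ l $ j)"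
      by (simp add: matrix_matrix_mult_def mat_def left_diff_distrib sum_subtractf sum_distrib_left
          mult.assoc if_distrib[of "\<lambda>x. x * _"] cong: if_cong)
    also have "\<dots> = v $ i * x $ j + (if j = k then 0 else P $ i $ j)"
      by (simp add: x_def algebra_simps) (simp add: P_def)
    also have "\<dots> = P $ i $ k * R $ k $ j + (\<Sum>l\<in>UNIV - {k}. P $ i $ l * R $ l $ j)"
      by (auto simp: R_def row_def mat_def P_def if_distrib[of "\<lambda>x. _ * x"] cong: if_cong)
    also have "\<dots> = (P ** R) $ i $ j"
      unfolding matrix_matrix_mult_def by (simp add: sum.remove[of UNIV k])
    finally show ?thesis .
  qed
  then have "(mat 1 - (\<chi> i j. v $ i * w $ j)) ** P = P ** R"
    by (simp add: vec_eq_iff)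
  then have "det (mat 1 - (\<chi> i j. v $ i * w $ j)) * det P = det P * det R"
    by (metis det_mul)
  with k show ?thesis
    by (simp add: detP detR)
qed

lemma matrix_diff_ldistrib:
  fixes A :: "'a::ring_1^'n^'m" and B :: "'a^'k^'n"
  shows "A ** (B - C) = A ** B - A ** C"
  by (simp add: matrix_matrix_mult_def vec_eq_iff right_diff_distrib sum_subtractf)

lemma mat_mult_vector: "(mat l :: 'a::comm_ring_1^'n^'n) *v v = l *s v"
  by (simp add: vec_eq_iff matrix_vector_mult_def mat_def if_distrib[of "\<lambda>x. x * _"] cong: if_cong)

lemma charpoly_root_eigenvector:
  fixes A :: "complex^'n^'n"
  assumes "poly (charpoly A) l = 0"
  obtains v where "v \<noteq> 0" "A *v v = l *s v"
proof -
  have "\<not> invertible (mat l - A)"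
    using assms by (simp add: poly_charpoly invertible_det_nz)
  then obtain v where v: "v \<noteq> 0" "(mat l - A) *v v = 0"
    by (metis invertible_left_inverse matrix_left_invertible_ker)
  then show ?thesis
    using that by (simp add: matrix_vector_mult_diff_rdistrib mat_mult_vector)
qed


section \<open>Hermitian inner product and deflation of eigenvalues\<close>

definition hdot :: "complex^'n \<Rightarrow> complex^'n \<Rightarrow> complex" where
  "hdot v w = (\<Sum>i\<in>UNIV. v $ i * cnj (w $ i))"

lemma hdot_linear:
  "hdot (v + v') w = hdot v w + hdot v' w" "hdot (c *s v) w = c * hdot v w"
  "hdot v (w + w') = hdot v w + hdot v w'" "hdot v (c *s w) = cnj c * hdot v w"
  by (simp_all add: hdot_def sum.distrib sum_distrib_left algebra_simps)

lemma hdot_commute: "hdot w v = cnj (hdot v w)"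
  by (simp add: hdot_def mult.commute)

lemma hdot_self: "hdot v v = of_real ((norm v)\<^sup>2)"
proof -
  have "(norm v)\<^sup>2 = (\<Sum>i\<in>UNIV. (cmod (v $ i))\<^sup>2)"
    by (simp add: norm_vec_def L2_set_def sum_nonneg)
  then show ?thesis
    by (simp only: hdot_def of_real_sum complex_norm_square)
qed

definition hermitian :: "complex^'n^'n \<Rightarrow> bool" where
  "hermitian A \<longleftrightarrow> (\<forall>i j. cnj (A $ i $ j) = A $ j $ i)"

lemma hdot_hermitian:
  assumes "hermitian A"
  shows "hdot (A *v v) w = hdot v (A *v w)"
proof -
  have "hdot (A *v v) w = (\<Sum>i\<in>UNIV. \<Sum>j\<in>UNIV. A $ i $ j * v $ j * cnj (w $ i))"
    by (simp add: hdot_def matrix_vector_mult_def sum_distrib_right)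
  also have "\<dots> = (\<Sum>j\<in>UNIV. \<Sum>i\<in>UNIV. A $ i $ j * v $ j * cnj (w $ i))"
    by (rule sum.swap)
  also have "\<dots> = (\<Sum>j\<in>UNIV. \<Sum>i\<in>UNIV. v $ j * cnj (A $ j $ i * w $ i))"
    using assms by (intro sum.cong refl) (auto simp: hermitian_def)
  also have "\<dots> = hdot v (A *v w)"
    by (simp add: hdot_def matrix_vector_mult_def sum_distrib_left)
  finally show ?thesis .
qed

lemma hermitian_eigenvalue_real:
  assumes "hermitian A" "A *v v = l *s v" "v \<noteq> 0"
  shows "l = of_real (Re l)"
proof -
  have "l * hdot v v = cnj l * hdot v v"
    using hdot_hermitian[OF assms(1), of v v] by (simp add: assms(2) hdot_linear)
  then have "l = cnj l"
    using assms(3) by (simp add: hdot_self)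
  then show ?thesis
    by (simp add: complex_eq_iff)
qed

text \<open>Moves one copy of the root \<open>l\<close> to \<open>m\<close> and keeps all other
  multiplicities. For \<open>x\<close> other than \<open>m\<close>, \<open>mat x - A\<close> is
  \<open>mat x - A'\<close> times a rank-one update of the identity, whose determinant is
  known.\<close>

lemma charpoly_deflate:
  fixes A :: "complex^'n^'n" and m :: complex
  assumes v: "A *v v = l *s v" "hdot v v = 1"
  defines "A' \<equiv> A + (\<chi> i j. (m - l) * (v $ i * cnj (v $ j)))"
  shows "charpoly A * [:- m, 1:] = charpoly A' * [:- l, 1:]"
proof -
  have A'v: "A' *v v = m *s v"
  proof -
    have "(A' *v v) $ i = m * v $ i" for i
    proof -
      have "(A' *v v) $ i = (A *v v) $ i + (m - l) * v $ i * hdot v v"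
        unfolding hdot_def sum_distrib_left A'_def
        by (simp add: matrix_vector_mult_def sum.distrib sum_subtractf algebra_simps)
      then show ?thesis
        using v by (simp add: algebra_simps)
    qed
    then show ?thesis by (simp add: vec_eq_iff)
  qed
  have det_eq: "det (mat x - A) * (x - m) = det (mat x - A') * (x - l)" if "x \<noteq> m" for x
  proof -
    \<comment> \<open>As \<open>mat x - A'\<close> multiplies \<open>v\<close> by
      \<open>x - m\<close>, this scaling makes its product with \<open>E\<close> equal to the
      difference between \<open>mat x - A'\<close> and \<open>mat x - A\<close>.\<close>
    define c where "c = (l - m) / (x - m)"
    define E where "E = (\<chi> i j. (c *s v) $ i * (\<chi> j. cnj (v $ j)) $ j)"
    have "((mat x - A') ** E) $ i $ j = (l - m) * (v $ i * cnj (v $ j))" for i j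
    proof -
      have "((mat x - A') ** E) $ i $ j = c * (((mat x - A') *v v) $ i * cnj (v $ j))"
        by (simp add: matrix_matrix_mult_def matrix_vector_mult_def E_def sum_distrib_left
            sum_distrib_right algebra_simps)
      also have "(mat x - A') *v v = (x - m) *s v"
        using A'v by (simp add: matrix_vector_mult_diff_rdistrib mat_mult_vector vec_eq_iff algebra_simps)
      also have "c * (((x - m) *s v) $ i * cnj (v $ j)) = c * (x - m) * (v $ i * cnj (v $ j))"
        by (simp only: vector_smult_component mult.assoc)
      also have "c * (x - m) = l - m"
        using that by (simp add: c_def)
      finally show ?thesis .
    qed
    then have "(mat x - A') ** (mat 1 - E) = mat x - A"
      by (simp add: matrix_diff_ldistrib vec_eq_iff) (simp add: A'_def algebra_simps)
    then have "det (mat x - A) = det (mat x - A') * det (mat 1 - E)"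
      by (metis det_mul)
    also have "det (mat 1 - E) = 1 - c * hdot v v"
      unfolding E_def det_rank_one_update by (simp add: hdot_def sum_distrib_left algebra_simps)
    finally show ?thesis
      using that v by (simp add: c_def field_simps)
  qed
  \<comment> \<open>The extra factor vanishes at \<open>x = m\<close>, where \<open>det_eq\<close>
    says nothing; it is cancelled afterwards in the polynomial ring.\<close>
  have "poly (charpoly A * [:- m, 1:] * [:- m, 1:]) x = poly (charpoly A' * [:- l, 1:] * [:- m, 1:]) x" for x
  proof -
    have "det (mat x - A) * (x - m) * (x - m) = det (mat x - A') * (x - l) * (x - m)"
      using det_eq[of x] by (cases "x = m") simp_all
    moreover have "poly [:- c, 1:] x = x - c" for c by simp
    ultimately show ?thesis
      by (simp only: poly_mult poly_charpoly)
  qed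
  then have "charpoly A * [:- m, 1:] * [:- m, 1:] = charpoly A' * [:- l, 1:] * [:- m, 1:]"
    by (metis poly_eq_poly_eq_iff ext)
  then show ?thesis
    by (simp only: mult_cancel_right) simp
qed

lemma hermitian_two_positive_eigenvectors:
  fixes A :: "complex^'n^'n"
  assumes A: "hermitian A" and num: "num_nonpos_eigenvalues A + 2 \<le> CARD('n)"
  obtains v w l m where "v \<noteq> 0" "w \<noteq> 0" "hdot w v = 0" "0 < l" "0 < m"
    "A *v v = of_real l *s v" "A *v w = of_real m *s w"
proof -
  let ?pos = "\<lambda>M. {#l \<in># M. 0 < Re l#}"
  have nz: "charpoly A \<noteq> 0"
    using degree_charpoly[of A] by auto
  have "size (proots (charpoly A)) = CARD('n)"
    by (simp add: size_proots_complex degree_charpoly)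
  moreover have "size (proots (charpoly A)) =
      num_nonpos_eigenvalues A + size (?pos (proots (charpoly A)))"
    unfolding num_nonpos_eigenvalues_def
    by (subst multiset_partition[of _ "\<lambda>l. Re l \<le> 0"]) (simp add: not_le)
  ultimately have two: "2 \<le> size (?pos (proots (charpoly A)))"
    using num by linarith
  then have "?pos (proots (charpoly A)) \<noteq> {#}"
    by (metis size_empty not_numeral_le_zero)
  then obtain l0 where "l0 \<in># ?pos (proots (charpoly A))"
    by (meson multiset_nonemptyE)
  then have l0: "0 < Re l0" "poly (charpoly A) l0 = 0"
    using nz by auto
  obtain v0 where v0: "v0 \<noteq> 0" "A *v v0 = l0 *s v0"
    using charpoly_root_eigenvector[OF l0(2)] by blast
  define v where "v = of_real (1 / norm v0) *s v0"
  have v_eq: "v = (1 / norm v0) *\<^sub>R v0"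
    unfolding vec_eq_iff vector_scaleR_component by (simp add: v_def scaleR_conv_of_real)
  then have "norm v = 1"
    using v0 by simp
  then have v: "v \<noteq> 0" "A *v v = l0 *s v" "hdot v v = 1"
    using v0 by (auto simp: v_def vector_scalar_commute hdot_self mult.commute)
  \<comment> \<open>The new eigenvalue \<open>- 1\<close> is real, so \<open>A'\<close> stays
    Hermitian, and it is not positive, so it cannot be mistaken for the second positive
    root.\<close>
  define A' where "A' = A + (\<chi> i j. (- 1 - l0) * (v $ i * cnj (v $ j)))"
  have l0_real: "l0 = of_real (Re l0)"
    by (rule hermitian_eigenvalue_real[OF A v(2,1)])
  have "cnj l0 = l0"
    by (metis l0_real complex_cnj_complex_of_real)
  then have A': "hermitian A'"
    using A by (simp add: hermitian_def A'_def mult.commute)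
  have defl: "charpoly A * [:1, 1:] = charpoly A' * [:- l0, 1:]"
    using charpoly_deflate[OF v(2,3), of "- 1"] by (simp add: A'_def)
  obtain r where r: "charpoly A = [:- l0, 1:] * r"
    using l0(2) by (meson dvdE poly_eq_0_iff_dvd)
  have A'r: "charpoly A' = r * [:1, 1:]"
  proof -
    have "[:- l0, 1:] * (r * [:1, 1:]) = [:- l0, 1:] * charpoly A'"
      using defl r by (simp only: mult_ac)
    then show ?thesis
      by (simp only: mult_cancel_left) auto
  qed
  have rz: "r \<noteq> 0" using nz r by auto
  have "proots (charpoly A) = {#l0#} + proots r"
    unfolding r using rz by (subst proots_mult) auto
  with two have "1 \<le> size (?pos (proots r))"
    using l0 by simp
  then have "?pos (proots r) \<noteq> {#}"
    by (metis size_empty not_one_le_zero)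
  then obtain m0 where "m0 \<in># ?pos (proots r)"
    by (meson multiset_nonemptyE)
  then have m0: "0 < Re m0" "poly (charpoly A') m0 = 0"
    using rz by (auto simp: A'r)
  obtain w where w: "w \<noteq> 0" "A' *v w = m0 *s w"
    using charpoly_root_eigenvector[OF m0(2)] by blast
  have m0_real: "m0 = of_real (Re m0)"
    by (rule hermitian_eigenvalue_real[OF A' w(2,1)])
  have A'_mult: "A' *v x = A *v x + ((- 1 - l0) * hdot x v) *s v" for x
    unfolding hdot_def A'_def
    by (simp add: vec_eq_iff matrix_vector_mult_def sum.distrib sum_subtractf sum_negf sum_distrib_left
        algebra_simps)
  have "A' *v v = (- 1) *s v"
    by (simp add: A'_mult v vec_eq_iff algebra_simps)
  then have "m0 * hdot w v = - hdot w v"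
    using hdot_hermitian[OF A', of w v] by (simp add: w hdot_linear) (simp add: hdot_def sum_negf)
  moreover have "m0 \<noteq> - 1"
    using m0 by auto
  ultimately have orth: "hdot w v = 0"
    by (metis mult_cancel_right mult_minus1)
  then have "A *v w = m0 *s w"
    using A'_mult[of w] w by simp
  then show ?thesis
    using that[OF v(1) w(1) orth, of "Re l0" "Re m0"] l0 m0 v l0_real m0_real by simp
qed

text \<open>Orthogonality of the eigenvectors removes the cross terms, so the form on their span is
  a sum of two positive squares.\<close>

lemma hermitian_two_positive_directions:
  fixes A :: "complex^'n^'n"
  assumes A: "hermitian A" and num: "num_nonpos_eigenvalues A + 2 \<le> CARD('n)"
  obtains v w where
    "\<And>a b. a \<noteq> 0 \<or> b \<noteq> 0 \<Longrightarrow> 0 < Re (hdot (A *v (a *s v + b *s w)) (a *s v + b *s w))"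
proof -
  obtain v w l m where *: "v \<noteq> 0" "w \<noteq> 0" "hdot w v = 0" "0 < l" "0 < m"
      "A *v v = of_real l *s v" "A *v w = of_real m *s w"
    using hermitian_two_positive_eigenvectors[OF assms] by blast
  have vw: "hdot v w = 0"
    using *(3) hdot_commute[of v w] by simp
  have "0 < Re (hdot (A *v (a *s v + b *s w)) (a *s v + b *s w))" if "a \<noteq> 0 \<or> b \<noteq> 0" for a b
  proof -
    have "hdot (A *v (a *s v + b *s w)) (a *s v + b *s w) =
        of_real l * (a * cnj a) * hdot v v + of_real m * (b * cnj b) * hdot w w"
      by (simp add: matrix_vector_right_distrib vector_scalar_commute * vw hdot_linear algebra_simps)
    also have "\<dots> = of_real (l * (cmod a)\<^sup>2 * (norm v)\<^sup>2 + m * (cmod b)\<^sup>2 * (norm w)\<^sup>2)"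
      by (simp add: hdot_self complex_norm_square[symmetric])
    finally have "Re (hdot (A *v (a *s v + b *s w)) (a *s v + b *s w)) =
        l * (cmod a)\<^sup>2 * (norm v)\<^sup>2 + m * (cmod b)\<^sup>2 * (norm w)\<^sup>2"
      by simp
    moreover have "0 < l * (cmod a)\<^sup>2 * (norm v)\<^sup>2" if "a \<noteq> 0"
      using that *(1,4) by simp
    moreover have "0 < m * (cmod b)\<^sup>2 * (norm w)\<^sup>2" if "b \<noteq> 0"
      using that *(2,5) by simp
    moreover have "0 \<le> l * (cmod a)\<^sup>2 * (norm v)\<^sup>2" "0 \<le> m * (cmod b)\<^sup>2 * (norm w)\<^sup>2"
      using *(4,5) by simp_all
    ultimately show ?thesis using that by linarith
  qed
  then show ?thesis using that by blast
qed

section \<open>The Levi form and the real Hessian\<close>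

lemma has_real_derivative_along_line:
  assumes "(f has_derivative f') (at (x + s *\<^sub>R v))"
  shows "((\<lambda>s. f (x + s *\<^sub>R v)) has_real_derivative f' v) (at s)"
proof -
  have "((\<lambda>s. x + s *\<^sub>R v) has_derivative (\<lambda>h. h *\<^sub>R v)) (at s)"
    by (auto intro!: derivative_eq_intros)
  from has_derivative_compose[OF this assms]
  have "((\<lambda>s. f (x + s *\<^sub>R v)) has_derivative (\<lambda>h. f' (h *\<^sub>R v))) (at s)" .
  moreover have "f' (h *\<^sub>R v) = f' v * h" for h
    using has_derivative_bounded_linear[OF assms] by (simp add: bounded_linear.linear linear_cmul)
  ultimately show ?thesis
    by (simp add: has_field_derivative_def)
qed

section \<open>Symmetry of the second derivative\<close>

locale C2_fun =
  fixes S :: "'v::real_normed_vector set" and u :: "'v \<Rightarrow> real"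
    and u' :: "'v \<Rightarrow> 'v \<Rightarrow>\<^sub>L real" and u'' :: "'v \<Rightarrow> 'v \<Rightarrow>\<^sub>L 'v \<Rightarrow>\<^sub>L real"
  assumes open_S: "open S"
    and deriv1: "x \<in> S \<Longrightarrow> (u has_derivative u' x) (at x)"
    and deriv2: "x \<in> S \<Longrightarrow> (u' has_derivative u'' x) (at x)"
    and cont2: "continuous_on S u''"
begin

lemma line_deriv1:
  "x + s *\<^sub>R v \<in> S \<Longrightarrow> ((\<lambda>s. u (x + s *\<^sub>R v)) has_real_derivative u' (x + s *\<^sub>R v) v) (at s)"
  by (intro has_real_derivative_along_line deriv1)

lemma line_deriv2:
  assumes "x + s *\<^sub>R v \<in> S"
  shows "((\<lambda>s. u' (x + s *\<^sub>R v) w) has_real_derivative u'' (x + s *\<^sub>R v) v w) (at s)"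
  by (rule has_real_derivative_along_line bounded_linear.has_derivative
      blinfun.bounded_linear_left deriv2 assms)+

lemma cont_u: "continuous_on S u"
  by (meson deriv1 continuous_at_imp_continuous_on has_derivative_continuous)

text \<open>The mean value theorem, used along \<open>v\<close> for the difference of two translates
  of \<open>u\<close> and then along \<open>w\<close> for \<open>u'\<close>. The left side is
  symmetric in \<open>v\<close> and \<open>w\<close>, while the right side records the order of
  differentiation.\<close>

lemma mixed_difference:
  assumes "ball x r \<subseteq> S" "0 < t" "t * (norm v + norm w) < r"
  obtains y where "norm (y - x) \<le> t * (norm v + norm w)"
    "u (x + t *\<^sub>R v + t *\<^sub>R w) - u (x + t *\<^sub>R v) - u (x + t *\<^sub>R w) + u x = t\<^sup>2 * u'' y w v"
proof -
  have bound: "norm (a *\<^sub>R v + b *\<^sub>R w) \<le> t * (norm v + norm w)"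
    if "0 \<le> a" "a \<le> t" "0 \<le> b" "b \<le> t" for a b
  proof -
    have "norm (a *\<^sub>R v + b *\<^sub>R w) \<le> a * norm v + b * norm w"
      using that by (intro norm_triangle_le) simp
    also have "\<dots> \<le> t * norm v + t * norm w"
      using that by (intro add_mono mult_right_mono) auto
    finally show ?thesis by (simp add: algebra_simps)
  qed
  have inS: "x + a *\<^sub>R v + b *\<^sub>R w \<in> S" if "0 \<le> a" "a \<le> t" "0 \<le> b" "b \<le> t" for a b
  proof -
    have "dist (x + (a *\<^sub>R v + b *\<^sub>R w)) x < r"
      using bound[OF that] assms(3) by (simp add: dist_norm)
    then show ?thesis using assms(1) by (auto simp: add.assoc dist_commute)
  qed
  have "((\<lambda>s. u (x + t *\<^sub>R w + s *\<^sub>R v) - u (x + s *\<^sub>R v)) has_real_derivative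
      u' (x + t *\<^sub>R w + s *\<^sub>R v) v - u' (x + s *\<^sub>R v) v) (at s)" if "0 \<le> s" "s \<le> t" for s
    using inS[of s t] inS[of s 0] that assms(2)
    by (intro DERIV_diff line_deriv1) (auto simp: algebra_simps)
  from MVT2[OF assms(2) this] obtain s where s: "0 < s" "s < t"
    "u (x + t *\<^sub>R w + t *\<^sub>R v) - u (x + t *\<^sub>R v) - (u (x + t *\<^sub>R w) - u x) =
      t * (u' (x + t *\<^sub>R w + s *\<^sub>R v) v - u' (x + s *\<^sub>R v) v)"
    by auto
  have "((\<lambda>b. u' (x + s *\<^sub>R v + b *\<^sub>R w) v) has_real_derivative
      u'' (x + s *\<^sub>R v + b *\<^sub>R w) w v) (at b)" if "0 \<le> b" "b \<le> t" for b
    using inS[of s b] that s by (intro line_deriv2) auto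
  from MVT2[OF assms(2) this] obtain b where b: "0 < b" "b < t"
    "u' (x + s *\<^sub>R v + t *\<^sub>R w) v - u' (x + s *\<^sub>R v) v = t * u'' (x + s *\<^sub>R v + b *\<^sub>R w) w v"
    by auto
  show ?thesis
  proof (rule that)
    show "norm (x + s *\<^sub>R v + b *\<^sub>R w - x) \<le> t * (norm v + norm w)"
      using bound[of s b] s b by (simp add: add.assoc)
    show "u (x + t *\<^sub>R v + t *\<^sub>R w) - u (x + t *\<^sub>R v) - u (x + t *\<^sub>R w) + u x =
        t\<^sup>2 * u'' (x + s *\<^sub>R v + b *\<^sub>R w) w v"
      using s(3) b(3) by (simp add: add_ac power2_eq_square)
  qed
qed

lemma cont2_apply: "continuous_on S (\<lambda>y. u'' y v w)"
  by (intro continuous_intros cont2)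

text \<open>One mixed difference equals \<open>t\<^sup>2\<close> times both orders of the
  derivative, each at some point close to \<open>x\<close>. Continuity would keep these two values
  apart if the orders disagreed at \<open>x\<close>.\<close>

lemma symmetric_second_derivative:
  assumes x: "x \<in> S"
  shows "u'' x v w = u'' x w v"
proof (rule ccontr)
  assume "u'' x v w \<noteq> u'' x w v"
  then have e: "0 < \<bar>u'' x v w - u'' x w v\<bar> / 2" (is "0 < ?e") by simp
  have at: "continuous (at x) (\<lambda>y. u'' y v w)" for v w
    using cont2_apply open_S x by (simp add: continuous_on_eq_continuous_at)
  obtain d1 where d1: "0 < d1" "\<And>y. norm (y - x) < d1 \<Longrightarrow> \<bar>u'' y v w - u'' x v w\<bar> < ?e"
    using at[of v w] e unfolding continuous_at_eps_delta dist_norm real_norm_def by blast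
  obtain d2 where d2: "0 < d2" "\<And>y. norm (y - x) < d2 \<Longrightarrow> \<bar>u'' y w v - u'' x w v\<bar> < ?e"
    using at[of w v] e unfolding continuous_at_eps_delta dist_norm real_norm_def by blast
  obtain r where r: "0 < r" "ball x r \<subseteq> S"
    using open_S x by (meson open_contains_ball)
  define d where "d = min r (min d1 d2)"
  define t where "t = d / (2 * (norm v + norm w + 1))"
  have pos: "0 < norm v + norm w + 1"
    by (smt (verit) norm_ge_zero)
  have d: "0 < d" using r d1 d2 by (simp add: d_def)
  then have t: "0 < t" using pos by (simp add: t_def)
  have "t * (norm v + norm w) < t * (2 * (norm v + norm w + 1))"
    using t pos by (intro mult_strict_left_mono) auto
  also have "\<dots> = d" using pos by (simp add: t_def)
  finally have td: "t * (norm v + norm w) < d" .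
  obtain y where y: "norm (y - x) \<le> t * (norm v + norm w)"
    "u (x + t *\<^sub>R v + t *\<^sub>R w) - u (x + t *\<^sub>R v) - u (x + t *\<^sub>R w) + u x = t\<^sup>2 * u'' y w v"
    using mixed_difference[OF r(2) t, of v w] td by (auto simp: d_def)
  obtain z where z: "norm (z - x) \<le> t * (norm w + norm v)"
    "u (x + t *\<^sub>R w + t *\<^sub>R v) - u (x + t *\<^sub>R w) - u (x + t *\<^sub>R v) + u x = t\<^sup>2 * u'' z v w"
    using mixed_difference[OF r(2) t, of w v] td by (auto simp: d_def add.commute)
  have "x + t *\<^sub>R w + t *\<^sub>R v = x + t *\<^sub>R v + t *\<^sub>R w"
    by simp
  then have "t\<^sup>2 * u'' y w v = t\<^sup>2 * u'' z v w"
    using y(2) z(2) by (simp only:)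
  then have "u'' y w v = u'' z v w"
    using t by simp
  moreover have "\<bar>u'' z v w - u'' x v w\<bar> < ?e" "\<bar>u'' y w v - u'' x w v\<bar> < ?e"
    using y(1) z(1) td d1(2)[of z] d2(2)[of y] by (auto simp: d_def add.commute)
  moreover have "\<bar>a - b\<bar> \<le> \<bar>c - a\<bar> + \<bar>c - b\<bar>" for a b c :: real
    by arith
  ultimately show False
    by (smt (verit, best) field_sum_of_halves)
qed

end

text \<open>The complex structure as a real-linear operator, the form in which a real Hessian can be
  composed with it.\<close>

definition mul_i :: "complex^'n \<Rightarrow> complex^'n" where "mul_i v = \<i> *s v"

lemma mul_i_simps:
  "mul_i (v + w) = mul_i v + mul_i w" "mul_i (r *\<^sub>R v) = r *\<^sub>R mul_i v" "mul_i (mul_i v) = - v"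
  "c *s v = Re c *\<^sub>R v + Im c *\<^sub>R mul_i v" "mul_i (- v) = - mul_i v" "mul_i 0 = 0"
proof -
  show "c *s v = Re c *\<^sub>R v + Im c *\<^sub>R mul_i v"
    unfolding vec_eq_iff mul_i_def vector_add_component vector_scaleR_component vector_smult_component
    by (simp add: complex_eq_iff)
qed (unfold vec_eq_iff mul_i_def vector_add_component vector_scaleR_component vector_smult_component
    vector_uminus_component zero_index, simp_all add: algebra_simps)

text \<open>The sesquilinear form whose matrix is the Levi matrix, in terms of the real Hessian \<open>H\<close>.\<close>

definition levi_form :: "((complex^'n) \<Rightarrow>\<^sub>L (complex^'n) \<Rightarrow>\<^sub>L real) \<Rightarrow> complex^'n \<Rightarrow> complex^'n \<Rightarrow> complex"
  where "levi_form H v w =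
    Complex (H v w + H (mul_i v) (mul_i w)) (H v (mul_i w) - H (mul_i v) w) / 4"

lemmas blinfun_bilinear_simps = blinfun.add_left blinfun.add_right blinfun.scaleR_left
  blinfun.scaleR_right blinfun.minus_left blinfun.minus_right blinfun.diff_left
  blinfun.diff_right blinfun.zero_left blinfun.zero_right

text \<open>Replacing \<open>v\<close> by \<open>mul_i v\<close> turns the real part into minus the
  imaginary part and the imaginary part into the real part, which is multiplication by
  \<open>\<i>\<close>.\<close>

lemma levi_form_linear:
  "levi_form H (v + v') w = levi_form H v w + levi_form H v' w"
  "levi_form H v (w + w') = levi_form H v w + levi_form H v w'"
  "levi_form H (c *s v) w = c * levi_form H v w"
  "levi_form H v (c *s w) = cnj c * levi_form H v w"
  by (simp_all add: levi_form_def mul_i_simps blinfun_bilinear_simps complex_eq_iff algebra_simps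
      add_divide_distrib diff_divide_distrib)

lemma levi_form_sum:
  "levi_form H (sum f A) (sum g B) = (\<Sum>i\<in>A. \<Sum>j\<in>B. levi_form H (f i) (g j))"
proof -
  have z: "levi_form H 0 w = 0" "levi_form H w 0 = 0" for w
    by (simp_all add: levi_form_def mul_i_simps blinfun_bilinear_simps complex_eq_iff)
  have "levi_form H v (sum g B) = (\<Sum>j\<in>B. levi_form H v (g j))" for v
    by (induction B rule: infinite_finite_induct) (simp_all add: z levi_form_linear)
  then show ?thesis
    by (induction A rule: infinite_finite_induct) (simp_all add: z levi_form_linear)
qed

text \<open>The Levi form is linear in the index \<open>j\<close> of the matrix entry and
  conjugate-linear in \<open>k\<close>, whereas \<open>hdot (A *v y) y\<close> pairs the indices the
  other way round. Conjugating the vector reconciles the two.\<close>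

definition cnj_vec :: "complex^'n \<Rightarrow> complex^'n" where "cnj_vec v = (\<chi> i. cnj (v $ i))"

locale C2_complex = C2_fun S u u' u''
  for S :: "(complex^'n) set" and u u' u''
begin

lemma levi_matrix_eq:
  assumes z: "z \<in> S"
  shows "levi_matrix u z $ j $ k = levi_form (u'' z) (axis j 1) (axis k 1)"
proof -
  have mi: "mul_i (axis j 1) = axis j \<i>" for j :: 'n
    by (simp add: mul_i_def axis_def vec_eq_iff)
  have fr: "frechet_derivative (\<lambda>w. complex_of_real (u w)) (at y) v = complex_of_real (u' y v)"
    if "y \<in> S" for y v
  proof -
    have "((\<lambda>w. complex_of_real (u w)) has_derivative (\<lambda>v. complex_of_real (u' y v))) (at y)"
      by (intro has_derivative_of_real deriv1 that)
    then show ?thesis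
      by (simp add: frechet_derivative_at[symmetric])
  qed
  have dzb: "d_zbar k (\<lambda>w. complex_of_real (u w)) y =
      (complex_of_real (u' y (axis k 1)) + \<i> * complex_of_real (u' y (axis k \<i>))) / 2" if "y \<in> S" for y
    using that by (simp add: d_zbar_def fr)
  have "((\<lambda>y. (complex_of_real (u' y (axis k 1)) + \<i> * complex_of_real (u' y (axis k \<i>))) / 2)
     has_derivative (\<lambda>v. (complex_of_real (u'' z v (axis k 1))
       + \<i> * complex_of_real (u'' z v (axis k \<i>))) / 2)) (at z)"
    by (rule derivative_eq_intros deriv2 z refl | simp)+
  \<comment> \<open>The outer derivative at \<open>z\<close> needs the values of
    \<open>d_zbar\<close> near \<open>z\<close>, not only at \<open>z\<close>; here openness of
    \<open>S\<close> is used.\<close>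
  then have "((d_zbar k (\<lambda>w. complex_of_real (u w)))
     has_derivative (\<lambda>v. (complex_of_real (u'' z v (axis k 1))
       + \<i> * complex_of_real (u'' z v (axis k \<i>))) / 2)) (at z)"
    by (rule has_derivative_transform_within_open[OF _ open_S z]) (simp add: dzb)
  then have "frechet_derivative (d_zbar k (\<lambda>w. complex_of_real (u w))) (at z) =
     (\<lambda>v. (complex_of_real (u'' z v (axis k 1)) + \<i> * complex_of_real (u'' z v (axis k \<i>))) / 2)"
    by (rule frechet_derivative_at[symmetric])
  then show ?thesis
    by (simp add: levi_matrix_def d_z_def levi_form_def mi complex_eq_iff)
qed

lemma hermitian_levi_matrix: "z \<in> S \<Longrightarrow> hermitian (levi_matrix u z)"
  using symmetric_second_derivative[of z]
  by (simp add: hermitian_def levi_matrix_eq levi_form_def complex_eq_iff)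

text \<open>The bridge to the real Hessian: on the diagonal the imaginary part cancels by symmetry,
  and what remains is a quarter of the Hessian summed over \<open>x\<close> and
  \<open>mul_i x\<close>. If it is positive, the Hessian is positive at one of the two.\<close>

lemma hdot_levi_matrix:
  assumes z: "z \<in> S"
  shows "hdot (levi_matrix u z *v cnj_vec x) (cnj_vec x) = of_real ((u'' z x x + u'' z (mul_i x) (mul_i x)) / 4)"
proof -
  have x: "(\<Sum>i\<in>UNIV. x $ i *s axis i 1) = x"
    by (rule basis_expansion)
  have "hdot (levi_matrix u z *v cnj_vec x) (cnj_vec x) =
      (\<Sum>i\<in>UNIV. \<Sum>j\<in>UNIV. levi_form (u'' z) (x $ i *s axis i 1) (x $ j *s axis j 1))"
    by (simp add: hdot_def matrix_vector_mult_def cnj_vec_def sum_distrib_left sum_distrib_right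
        levi_matrix_eq[OF z] levi_form_linear algebra_simps)
  also have "\<dots> = levi_form (u'' z) x x"
    unfolding levi_form_sum[symmetric] x ..
  also have "\<dots> = of_real ((u'' z x x + u'' z (mul_i x) (mul_i x)) / 4)"
    using symmetric_second_derivative[OF z] by (simp add: levi_form_def complex_eq_iff)
  finally show ?thesis .
qed

text \<open>With \<open>e\<close> chosen, \<open>f\<close> is found in the kernel of the complex linear functional
  \<open>w \<mapsto> H e w - \<i> H e (\<i> w)\<close> on the complex plane where the Levi form is positive: there
  both \<open>f\<close> and \<open>\<i> f\<close> are \<open>H\<close>-orthogonal to \<open>e\<close>, and \<open>H\<close> is positive on one of them.\<close>

lemma two_positive_directions:
  assumes z: "z \<in> S" and num: "num_nonpos_eigenvalues (levi_matrix u z) + 2 \<le> CARD('n)"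
  obtains e f where "u'' z e e = 1" "u'' z f f = 1" "u'' z e f = 0"
proof -
  define H where "H = u'' z"
  obtain v0 w0 where *: "\<And>a b. a \<noteq> 0 \<or> b \<noteq> 0 \<Longrightarrow>
      0 < Re (hdot (levi_matrix u z *v (a *s v0 + b *s w0)) (a *s v0 + b *s w0))"
    using hermitian_two_positive_directions[OF hermitian_levi_matrix[OF z] num] by blast
  define v w where "v = cnj_vec v0" and "w = cnj_vec w0"
  have pos: "0 < H x x + H (mul_i x) (mul_i x)"
    if "a \<noteq> 0 \<or> b \<noteq> 0" and x: "x = a *s v + b *s w" for a b x
  proof -
    have "cnj_vec x = cnj a *s v0 + cnj b *s w0"
      by (simp add: x v_def w_def cnj_vec_def vec_eq_iff)
    then have "0 < Re (hdot (levi_matrix u z *v cnj_vec x) (cnj_vec x))"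
      using *[of "cnj a" "cnj b"] that by simp
    then show ?thesis
      by (simp add: hdot_levi_matrix[OF z] H_def)
  qed
  have "0 < H v v + H (mul_i v) (mul_i v)"
    by (rule pos[of 1 0]) auto
  then have "0 < H v v \<or> 0 < H (mul_i v) (mul_i v)"
    by linarith
  then obtain e where e: "0 < H e e" by blast
  define g where "g x = Complex (H e x) (- H e (mul_i x))" for x
  have g_linear: "g (x + y) = g x + g y" "g (c *s x) = c * g x" for x y c
    by (simp_all add: g_def mul_i_simps blinfun_bilinear_simps complex_eq_iff algebra_simps)
  obtain a b where ab: "a \<noteq> 0 \<or> b \<noteq> 0" "a * g v + b * g w = 0"
  proof (cases "g v = 0")
    case True
    then show ?thesis using that[of 1 0] by simp
  next
    case False
    then show ?thesis using that[of "- g w" "g v"] by simp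
  qed
  define x where "x = a *s v + b *s w"
  have "g x = 0"
    using ab by (simp add: x_def g_linear)
  then have "H e x = 0" "H e (mul_i x) = 0"
    by (simp_all add: g_def complex_eq_iff)
  moreover have "0 < H x x \<or> 0 < H (mul_i x) (mul_i x)"
    using pos[OF ab(1) x_def] by linarith
  ultimately obtain f where f: "0 < H f f" "H e f = 0"
    by blast
  show ?thesis
  proof (rule that)
    show "u'' z ((1 / sqrt (H e e)) *\<^sub>R e) ((1 / sqrt (H e e)) *\<^sub>R e) = 1"
      using e by (simp add: blinfun_bilinear_simps H_def[symmetric])
    show "u'' z ((1 / sqrt (H f f)) *\<^sub>R f) ((1 / sqrt (H f f)) *\<^sub>R f) = 1"
      using f by (simp add: blinfun_bilinear_simps H_def[symmetric])
    show "u'' z ((1 / sqrt (H e e)) *\<^sub>R e) ((1 / sqrt (H f f)) *\<^sub>R f) = 0"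
      using f by (simp add: blinfun_bilinear_simps H_def[symmetric])
  qed
qed

end

section \<open>Local connectedness of superlevel sets\<close>

text \<open>Reduces connectedness of a local superlevel set to finding an evidently connected part
  \<open>C\<close> and a path from every point into \<open>C\<close> that does not descend.\<close>

lemma connected_if_joined_to_core:
  assumes "connected C" "C \<noteq> {}" "C \<subseteq> G"
    and T: "\<And>x. x \<in> G \<Longrightarrow> \<exists>T. connected T \<and> x \<in> T \<and> T \<subseteq> G \<and> T \<inter> C \<noteq> {}"
  shows "connected G"
proof -
  define F where "F = {T \<union> C | T. connected T \<and> T \<subseteq> G \<and> T \<inter> C \<noteq> {}}"
  have "x \<in> \<Union>F" if x: "x \<in> G" for x
  proof -
    obtain T where "connected T" "x \<in> T" "T \<subseteq> G" "T \<inter> C \<noteq> {}"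
      using T[OF x] by blast
    then have "T \<union> C \<in> F" "x \<in> T \<union> C"
      unfolding F_def by blast+
    then show ?thesis by (rule UnionI)
  qed
  moreover have "\<Union>F \<subseteq> G"
    using \<open>C \<subseteq> G\<close> by (auto simp: F_def)
  ultimately have "\<Union>F = G" by blast
  moreover have "connected (\<Union>F)"
  proof (rule connected_Union)
    show "connected A" if "A \<in> F" for A
      using that \<open>connected C\<close> by (auto simp: F_def intro: connected_Un)
    have "C \<subseteq> \<Inter>F" by (auto simp: F_def)
    then show "\<Inter>F \<noteq> {}"
      using \<open>C \<noteq> {}\<close> by blast
  qed
  ultimately show ?thesis by simp
qed

text \<open>The union is the Minkowski sum of \<open>K\<close> and a ball, a continuous image of
  their product.\<close>

lemma connected_UN_ball:
  fixes K :: "'v::real_normed_vector set"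
  assumes "connected K"
  shows "connected (\<Union>k\<in>K. ball k d)"
proof -
  have "(\<Union>k\<in>K. ball k d) = (\<lambda>(k, y). k + y) ` (K \<times> ball 0 d)"
  proof (intro set_eqI iffI)
    fix x assume "x \<in> (\<Union>k\<in>K. ball k d)"
    then obtain k where "k \<in> K" "dist k x < d" by auto
    then show "x \<in> (\<lambda>(k, y). k + y) ` (K \<times> ball 0 d)"
      by (intro image_eqI[of _ _ "(k, x - k)"]) (auto simp: dist_norm norm_minus_commute)
  qed (force simp: dist_norm)
  moreover have "connected \<dots>"
    using assms
    by (intro connected_continuous_image connected_Times convex_connected[OF convex_ball])
      (auto intro!: continuous_intros simp: case_prod_unfold)
  ultimately show ?thesis by simp
qed

context C2_fun
begin

text \<open>Taylor's formula with an unspecified positive factor \<open>s1\<close>; the arguments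
  below use only the sign of the second-order term.\<close>

lemma ray_second_order:
  assumes t: "0 < t" and S: "\<And>s. 0 \<le> s \<Longrightarrow> s \<le> t \<Longrightarrow> x + s *\<^sub>R v \<in> S"
  obtains s1 s2 where "0 < s1" "0 < s2" "s2 < t"
    "u (x + t *\<^sub>R v) = u x + t * (u' x v + s1 * u'' (x + s2 *\<^sub>R v) v v)"
proof -
  have "((\<lambda>s. u (x + s *\<^sub>R v)) has_real_derivative u' (x + s *\<^sub>R v) v) (at s)"
    if "0 \<le> s" "s \<le> t" for s
    using S that by (intro line_deriv1)
  from MVT2[OF t this] obtain s1 where s1: "0 < s1" "s1 < t"
    "u (x + t *\<^sub>R v) - u x = t * u' (x + s1 *\<^sub>R v) v"
    by auto
  have "((\<lambda>s. u' (x + s *\<^sub>R v) v) has_real_derivative u'' (x + s *\<^sub>R v) v v) (at s)"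
    if "0 \<le> s" "s \<le> s1" for s
    using S that s1 by (intro line_deriv2) auto
  from MVT2[OF s1(1) this] obtain s2 where s2: "0 < s2" "s2 < s1"
    "u' (x + s1 *\<^sub>R v) v - u' x v = s1 * u'' (x + s2 *\<^sub>R v) v v"
    by auto
  then have "u' (x + s1 *\<^sub>R v) v = u' x v + s1 * u'' (x + s2 *\<^sub>R v) v v"
    by linarith
  with s1 s2 show ?thesis
    by (intro that[of s1 s2]) auto
qed

lemma open_superlevel: "open {x \<in> S. c < u x}"
proof -
  have "{x \<in> S. c < u x} = S \<inter> u -` {c<..}" by auto
  then show ?thesis
    using continuous_open_preimage[OF cont_u open_S, of "{c<..}"] by simp
qed

text \<open>Near \<open>z\<close> the function increases along \<open>v\<close>, so every point
  above the level of \<open>z\<close> in a thin tube around a segment in direction \<open>v\<close>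
  can be pushed into the ball at the upper end, which lies entirely above that level.\<close>

lemma local_superlevel_connected_regular:
  assumes z: "z \<in> W" and W: "open W" "W \<subseteq> S" and v: "0 < u' z v"
  shows "\<exists>N. open N \<and> z \<in> N \<and> N \<subseteq> W \<and> connected {x \<in> N. u z < u x} \<and> {x \<in> N. u z < u x} \<noteq> {}"
proof -
  have "continuous (at z) u'"
    using deriv2 z W has_derivative_continuous by blast
  then have "isCont (\<lambda>y. u' y v) z"
    by (intro continuous_intros)
  then have "\<forall>\<^sub>F y in nhds z. 0 < u' y v"
    using v by (simp add: continuous_at tendsto_nhds_iff order_tendstoD(1))
  moreover have "\<forall>\<^sub>F y in nhds z. y \<in> W"
    using z W by (simp add: eventually_nhds_in_open)
  ultimately have "\<forall>\<^sub>F y in nhds z. 0 < u' y v \<and> y \<in> W"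
    by (rule eventually_conj)
  then obtain R where R: "0 < R" "\<And>y. dist y z < R \<Longrightarrow> 0 < u' y v" "\<And>y. dist y z < R \<Longrightarrow> y \<in> W"
    unfolding eventually_nhds_metric by blast
  \<comment> \<open>Half of \<open>R\<close> is reserved for the length of the segment and the other
    half for the thickness \<open>d\<close> of the tube, so that the tube stays within distance
    \<open>R\<close> of \<open>z\<close>.\<close>
  define r where "r = R / (2 * (norm v + 1))"
  have pos: "0 < norm v + 1"
    by (smt (verit) norm_ge_zero)
  have r: "0 < r" using R pos by (simp add: r_def)
  have "r * norm v \<le> r * (norm v + 1)"
    using r by (intro mult_left_mono) auto
  also have "\<dots> = R / 2"
    using pos by (simp add: r_def field_simps)
  finally have rv: "r * norm v \<le> R / 2" .
  have mono: "u x \<le> u (x + t *\<^sub>R v)" "0 < t \<Longrightarrow> u x < u (x + t *\<^sub>R v)"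
    if "0 \<le> t" "\<And>s. 0 \<le> s \<Longrightarrow> s \<le> t \<Longrightarrow> dist (x + s *\<^sub>R v) z < R" for x t
  proof -
    show less: "u x < u (x + t *\<^sub>R v)" if "0 < t"
    proof -
      have "\<exists>y. ((\<lambda>s. u (x + s *\<^sub>R v)) has_real_derivative y) (at s) \<and> 0 < y"
        if "0 \<le> s" "s \<le> t" for s
        using that \<open>\<And>s. 0 \<le> s \<Longrightarrow> s \<le> t \<Longrightarrow> dist (x + s *\<^sub>R v) z < R\<close> R W line_deriv1
        by (meson subsetD)
      from DERIV_pos_imp_increasing[OF \<open>0 < t\<close> this] show ?thesis
        by simp
    qed
    show "u x \<le> u (x + t *\<^sub>R v)"
      using less \<open>0 \<le> t\<close> by (cases "t = 0") auto
  qed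
  have "u z < u (z + r *\<^sub>R v)"
  proof (rule mono(2))
    show "dist (z + s *\<^sub>R v) z < R" if "0 \<le> s" "s \<le> r" for s
      using mult_right_mono[of s r "norm v"] that rv R by (simp add: dist_norm)
  qed (use r in auto)
  moreover have "z + r *\<^sub>R v \<in> S"
    using R(3)[of "z + r *\<^sub>R v"] W rv r R(1) by (auto simp: dist_norm)
  moreover have "open {x \<in> S. u z < u x}"
    by (rule open_superlevel)
  ultimately obtain d0 where d0: "0 < d0" "ball (z + r *\<^sub>R v) d0 \<subseteq> {x \<in> S. u z < u x}"
    by (metis (mono_tags, lifting) mem_Collect_eq open_contains_ball)
  define d where "d = min d0 (R / 2)"
  have d: "0 < d" using d0 R by (simp add: d_def)
  define N where "N = (\<Union>t\<in>{-r..r}. ball (z + t *\<^sub>R v) d)"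
  define C where "C = ball (z + r *\<^sub>R v) d"
  have near: "dist x z < R" if x: "x \<in> N" for x
  proof -
    obtain t where "t \<in> {-r..r}" "x \<in> ball (z + t *\<^sub>R v) d"
      using x unfolding N_def by blast
    then have t: "\<bar>t\<bar> \<le> r" "dist (z + t *\<^sub>R v) x < R / 2"
      by (auto simp: d_def)
    have "dist (z + t *\<^sub>R v) z \<le> R / 2"
      using mult_right_mono[OF t(1), of "norm v"] rv by (simp add: dist_norm)
    then show ?thesis
      using t(2) dist_triangle3[of x z "z + t *\<^sub>R v"] by linarith
  qed
  have CN: "C \<subseteq> {x \<in> N. u z < u x}"
    using d0 r by (auto simp: C_def N_def d_def intro!: bexI[of _ r])
  have "connected {x \<in> N. u z < u x}"
  proof (rule connected_if_joined_to_core[of C])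
    show "connected C" "C \<noteq> {}" "C \<subseteq> {x \<in> N. u z < u x}"
      using CN d by (auto simp: C_def)
    fix x assume "x \<in> {x \<in> N. u z < u x}"
    then obtain t where t: "- r \<le> t" "t \<le> r" "dist (z + t *\<^sub>R v) x < d" and x: "u z < u x"
      by (auto simp: N_def)
    have shift: "dist (z + (t + s) *\<^sub>R v) (x + s *\<^sub>R v) < d" for s
      using t(3) by (simp add: dist_norm algebra_simps)
    have inN: "x + s *\<^sub>R v \<in> N" if "0 \<le> s" "s \<le> r - t" for s
      unfolding N_def using shift[of s] that t by (intro UN_I[of "t + s"]) auto
    have up: "u x \<le> u (x + s *\<^sub>R v)" if "0 \<le> s" "s \<le> r - t" for s
      using that by (intro mono(1) near inN) auto
    let ?T = "(\<lambda>s. x + s *\<^sub>R v) ` {0..r - t}"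
    have "connected ?T"
      by (intro connected_continuous_image continuous_intros) auto
    moreover have "x \<in> ?T"
      using t by (intro image_eqI[of _ _ 0]) auto
    moreover have "?T \<subseteq> {x \<in> N. u z < u x}"
      using inN up x by fastforce
    moreover have "x + (r - t) *\<^sub>R v \<in> ?T \<inter> C"
      using shift[of "r - t"] t by (auto simp: C_def)
    ultimately show "\<exists>T. connected T \<and> x \<in> T \<and> T \<subseteq> {x \<in> N. u z < u x} \<and> T \<inter> C \<noteq> {}"
      by blast
  qed
  moreover have "open N" "z \<in> N"
    using d r by (auto simp: N_def intro!: bexI[of _ 0])
  moreover have "N \<subseteq> W"
    using near R(3) by blast
  moreover have "{x \<in> N. u z < u x} \<noteq> {}"
  proof -
    have "z + r *\<^sub>R v \<in> C" using d by (simp add: C_def)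
    with CN show ?thesis by blast
  qed
  ultimately show ?thesis by blast
qed

text \<open>On the translates of a small disc in the plane of \<open>e\<close> and \<open>f\<close> the function is strictly
  convex, so from any point one can reach the boundary circle along \<open>e\<close> or \<open>-e\<close> without
  descending. The circle is connected because the plane has dimension two.\<close>

lemma local_superlevel_connected_critical:
  assumes z: "z \<in> W" and W: "open W" "W \<subseteq> S" and crit: "u' z = 0"
    and ef: "u'' z e e = 1" "u'' z f f = 1" "u'' z e f = 0"
  shows "\<exists>N. open N \<and> z \<in> N \<and> N \<subseteq> W \<and> connected {x \<in> N. u z < u x} \<and> {x \<in> N. u z < u x} \<noteq> {}"
proof -
  have zS: "z \<in> S" using z W by blast
  \<comment> \<open>With error \<open>1/4\<close> the diagonal terms keep at least
    \<open>3/4\<close> of the squares, and the mixed terms cost at most a quarter of their sum, by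
    \<open>2 * \<bar>a * b\<bar> \<le> a\<^sup>2 + b\<^sup>2\<close>. Half of the sum of squares is
    left.\<close>
  have ev: "\<forall>\<^sub>F y in nhds z. \<bar>u'' y a b - u'' z a b\<bar> < 1/4" for a b
  proof -
    have "isCont (\<lambda>y. u'' y a b) z"
      using cont2_apply open_S zS by (simp add: continuous_on_eq_continuous_at)
    then have "((\<lambda>y. u'' y a b) \<longlongrightarrow> u'' z a b) (nhds z)"
      by (simp add: continuous_at tendsto_nhds_iff)
    from tendstoD[OF this, of "1/4"] show ?thesis
      by (simp add: dist_real_def)
  qed
  have "\<forall>\<^sub>F y in nhds z. y \<in> W \<and> \<bar>u'' y e e - 1\<bar> < 1/4 \<and> \<bar>u'' y f f - 1\<bar> < 1/4 \<and>
      \<bar>u'' y e f\<bar> < 1/4 \<and> \<bar>u'' y f e\<bar> < 1/4"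
    using z W(1) ev[of e e] ev[of f f] ev[of e f] ev[of f e] ef symmetric_second_derivative[OF zS, of f e]
    by (auto intro!: eventually_conj eventually_nhds_in_open)
  then obtain R where R: "0 < R" "\<And>y. dist y z < R \<Longrightarrow> y \<in> W"
    and D: "\<And>y. dist y z < R \<Longrightarrow> \<bar>u'' y e e - 1\<bar> < 1/4 \<and> \<bar>u'' y f f - 1\<bar> < 1/4 \<and>
      \<bar>u'' y e f\<bar> < 1/4 \<and> \<bar>u'' y f e\<bar> < 1/4"
    unfolding eventually_nhds_metric by blast
  \<comment> \<open>Complex numbers serve only as coordinates of the real plane of \<open>e\<close>
    and \<open>f\<close>, so that discs and circles can be described by the modulus;
    \<open>k\<close> is real linear.\<close>
  define k where "k c = Re c *\<^sub>R e + Im c *\<^sub>R f" for c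
  have pos_def: "0 < u'' y (k c) (k c)" if "dist y z < R" "c \<noteq> 0" for y c
  proof -
    let ?a = "Re c" and ?b = "Im c"
    have "u'' y (k c) (k c) = ?a\<^sup>2 * u'' y e e + ?a * ?b * (u'' y e f + u'' y f e) + ?b\<^sup>2 * u'' y f f"
      by (simp add: k_def blinfun_bilinear_simps power2_eq_square algebra_simps)
    moreover have "3/4 * ?a\<^sup>2 \<le> ?a\<^sup>2 * u'' y e e" "3/4 * ?b\<^sup>2 \<le> ?b\<^sup>2 * u'' y f f"
      using D[OF that(1)] mult_left_mono[of "3/4" "u'' y e e" "?a\<^sup>2"]
        mult_left_mono[of "3/4" "u'' y f f" "?b\<^sup>2"] by (auto simp: abs_if split: if_splits)
    moreover have "\<bar>?a * ?b * (u'' y e f + u'' y f e)\<bar> \<le> \<bar>?a * ?b\<bar> * (1/2)"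
      unfolding abs_mult[of "?a * ?b"] using D[OF that(1)] abs_triangle_ineq[of "u'' y e f" "u'' y f e"]
      by (intro mult_left_mono) auto
    moreover have "2 * \<bar>?a * ?b\<bar> \<le> ?a\<^sup>2 + ?b\<^sup>2"
      using sum_squares_bound[of "\<bar>?a\<bar>" "\<bar>?b\<bar>"] by (simp add: abs_mult)
    moreover have "0 < ?a\<^sup>2 + ?b\<^sup>2"
      using that(2) by (simp add: complex_neq_0)
    ultimately show ?thesis by linarith
  qed
  define r where "r = R / (2 * (norm e + norm f + 1))"
  have pos: "0 < norm e + norm f + 1"
    by (smt (verit) norm_ge_zero)
  have r: "0 < r" using R pos by (simp add: r_def)
  have k_le: "norm (k c) \<le> R / 2" if "cmod c \<le> r" for c
  proof -
    have "norm (k c) \<le> \<bar>Re c\<bar> * norm e + \<bar>Im c\<bar> * norm f"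
      unfolding k_def by (intro norm_triangle_le) simp
    also have "\<dots> \<le> r * norm e + r * norm f"
      using that abs_Re_le_cmod[of c] abs_Im_le_cmod[of c] by (intro add_mono mult_right_mono) auto
    also have "\<dots> \<le> r * (norm e + norm f + 1)"
      using r by (simp add: algebra_simps)
    also have "\<dots> = R / 2"
      using pos by (simp add: r_def field_simps)
    finally show ?thesis .
  qed
  have k_scale: "k (of_real s * c) = s *\<^sub>R k c" for s c
    by (simp add: k_def algebra_simps)
  \<comment> \<open>At the critical point the first-order term vanishes, so positive definiteness
    makes \<open>u\<close> exceed \<open>u z\<close> at the end of every radius.\<close>
  have circle: "z + k c \<in> {x \<in> S. u z < u x}" if "cmod c = r" for c
  proof -
    have near: "dist (z + s *\<^sub>R k c) z < R" if "0 \<le> s" "s \<le> 1" for s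
    proof -
      have "s * norm (k c) \<le> 1 * (R / 2)"
        using that k_le[of c] \<open>cmod c = r\<close> R by (intro mult_mono) auto
      then show ?thesis
        using that R by (simp add: dist_norm)
    qed
    then have "z + s *\<^sub>R k c \<in> S" if "0 \<le> s" "s \<le> 1" for s
      using R W that by blast
    then obtain s1 s2 where s: "0 < s1" "0 < s2" "s2 < 1"
      "u (z + 1 *\<^sub>R k c) = u z + 1 * (u' z (k c) + s1 * u'' (z + s2 *\<^sub>R k c) (k c) (k c))"
      using ray_second_order[of 1 z "k c"] by (metis zero_less_one)
    moreover have "0 < u'' (z + s2 *\<^sub>R k c) (k c) (k c)"
      using near[of s2] s that r by (intro pos_def) auto
    ultimately have "u z < u (z + k c)"
      by (simp add: crit)
    then show ?thesis
      using near[of 1] R W by auto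
  qed
  let ?C0 = "(\<lambda>c. z + k c) ` sphere 0 r"
  have cont_k: "continuous_on A (\<lambda>c. z + k c)" for A
    unfolding k_def by (intro continuous_intros)
  have "open {x \<in> S. u z < u x}"
    by (rule open_superlevel)
  moreover have "compact ?C0"
    by (intro compact_continuous_image cont_k compact_sphere)
  moreover have "?C0 \<subseteq> {x \<in> S. u z < u x}"
    by (intro image_subsetI circle) simp
  ultimately obtain d0 where d0: "0 < d0" "(\<Union>x\<in>?C0. ball x d0) \<subseteq> {x \<in> S. u z < u x}"
    by (metis compact_subset_open_imp_ball_epsilon_subset)
  define d where "d = min d0 (R / 2)"
  have d: "0 < d" using d0 R by (simp add: d_def)
  define N where "N = (\<Union>c\<in>cball 0 r. ball (z + k c) d)"
  define C where "C = (\<Union>x\<in>?C0. ball x d)"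
  have near: "dist x z < R" if x: "x \<in> N" for x
  proof -
    obtain c where "c \<in> cball 0 r" "x \<in> ball (z + k c) d"
      using x unfolding N_def by blast
    then have c: "cmod c \<le> r" "dist (z + k c) x < R / 2"
      by (auto simp: d_def)
    have "dist (z + k c) z \<le> R / 2"
      using k_le[OF c(1)] by (simp add: dist_norm)
    then show ?thesis
      using c(2) dist_triangle3[of x z "z + k c"] by linarith
  qed
  have CN: "C \<subseteq> {x \<in> N. u z < u x}"
  proof
    fix x assume "x \<in> C"
    then obtain c where c: "cmod c = r" "dist (z + k c) x < d"
      by (auto simp: C_def)
    then have "x \<in> N" by (auto simp: N_def intro!: bexI[of _ c])
    moreover have "x \<in> (\<Union>x\<in>?C0. ball x d0)"
      using c by (auto simp: d_def intro!: bexI[of _ c])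
    ultimately show "x \<in> {x \<in> N. u z < u x}"
      using d0(2) by blast
  qed
  have "of_real r \<in> sphere (0::complex) r"
    using r by simp
  then have C_ne: "C \<noteq> {}"
    using d unfolding C_def by (metis (no_types, lifting) UN_I centre_in_ball empty_iff imageI)
  have "connected {x \<in> N. u z < u x}"
  proof (rule connected_if_joined_to_core[of C])
    show "connected C"
      unfolding C_def
      by (intro connected_UN_ball connected_continuous_image cont_k connected_sphere) simp
    show "C \<noteq> {}" "C \<subseteq> {x \<in> N. u z < u x}"
      by fact+
    fix x assume "x \<in> {x \<in> N. u z < u x}"
    then obtain c where c: "cmod c \<le> r" "dist (z + k c) x < d" and x: "u z < u x" "x \<in> N"
      by (auto simp: N_def)
    \<comment> \<open>The sign makes the first-order term of \<open>u\<close> at \<open>x\<close>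
      nonnegative along \<open>g *\<^sub>R e\<close>; convexity then prevents any descent further
      out.\<close>
    define g where "g = (if 0 \<le> u' x e then 1 else - 1 :: real)"
    have g: "g * g = 1" "0 \<le> g * u' x e" "\<bar>g\<bar> = 1"
      by (auto simp: g_def)
    \<comment> \<open>\<open>h\<close> is half the length of the chord of the disc through
      \<open>c\<close> parallel to the real axis. Below, \<open>L\<close> is the distance from
      \<open>c\<close> along this chord to the circle in the direction given by
      \<open>g\<close>.\<close>
    define h where "h = sqrt (r\<^sup>2 - (Im c)\<^sup>2)"
    have c_sq: "(Re c)\<^sup>2 + (Im c)\<^sup>2 \<le> r\<^sup>2"
      using c(1) by (metis cmod_power2 norm_ge_zero power_mono)
    then have h: "0 \<le> h" "h\<^sup>2 = r\<^sup>2 - (Im c)\<^sup>2"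
      unfolding h_def by (smt (verit) real_sqrt_ge_zero zero_le_power2, smt (verit) real_sqrt_pow2 zero_le_power2)
    have g_sq: "g\<^sup>2 = 1"
      using g(1) by (simp only: power2_eq_square)
    then have "(g * Re c)\<^sup>2 \<le> h\<^sup>2"
      using c_sq h(2) by (simp add: power_mult_distrib)
    then have "\<bar>g * Re c\<bar> \<le> \<bar>h\<bar>"
      by (simp only: abs_le_square_iff)
    then have "\<bar>g * Re c\<bar> \<le> h"
      using h(1) by simp
    then have gc: "- h \<le> g * Re c" "g * Re c \<le> h" by linarith+
    define L where "L = h - g * Re c"
    have norm_c: "(cmod (c + of_real (s * g)))\<^sup>2 = (g * Re c + s)\<^sup>2 + (Im c)\<^sup>2" for s
    proof -
      have "Re c + s * g = g * g * Re c + s * g"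
        by (simp only: g(1) mult_1_left)
      also have "\<dots> = g * (g * Re c + s)"
        by (simp add: algebra_simps)
      finally have "(Re c + s * g)\<^sup>2 = (g * Re c + s)\<^sup>2"
        by (simp only: power_mult_distrib g_sq mult_1_left)
      then show ?thesis
        by (simp add: cmod_power2)
    qed
    have k_shift: "k (c + of_real (s * g)) = k c + s *\<^sub>R (g *\<^sub>R e)" for s
      by (simp add: k_def algebra_simps)
    have shift: "dist (z + k (c + of_real (s * g))) (x + s *\<^sub>R (g *\<^sub>R e)) < d" for s
    proof -
      have "z + (k c + w) - (x + w) = z + k c - x" for w
        by simp
      then show ?thesis
        using c(2) unfolding k_shift dist_norm by (simp only:)
    qed
    have inN: "x + s *\<^sub>R (g *\<^sub>R e) \<in> N" if "0 \<le> s" "s \<le> L" for s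
    proof -
      have "\<bar>g * Re c + s\<bar> \<le> h"
        using that gc by (auto simp: L_def)
      then have "(g * Re c + s)\<^sup>2 \<le> h\<^sup>2"
        by (metis abs_ge_zero power2_abs power_mono)
      then have "(cmod (c + of_real (s * g)))\<^sup>2 \<le> r\<^sup>2"
        unfolding norm_c using h(2) by linarith
      then have "cmod (c + of_real (s * g)) \<le> r"
        by (rule power2_le_imp_le) (use r in simp)
      then show ?thesis
        unfolding N_def using shift[of s]
        by (intro UN_I[of "c + of_real (s * g)"]) (simp_all only: mem_cball_0 mem_ball)
    qed
    have up: "u x \<le> u (x + s *\<^sub>R (g *\<^sub>R e))" if "0 \<le> s" "s \<le> L" for s
    proof (cases "s = 0")
      case False
      with that have "0 < s" by simp
      have inS: "x + t *\<^sub>R (g *\<^sub>R e) \<in> S" if "0 \<le> t" "t \<le> s" for t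
        using inN[of t] near R W that \<open>s \<le> L\<close> by (meson order_trans subsetD)
      obtain s1 s2 where s: "0 < s1" "0 < s2" "s2 < s"
        "u (x + s *\<^sub>R (g *\<^sub>R e)) = u x + s * (u' x (g *\<^sub>R e) +
          s1 * u'' (x + s2 *\<^sub>R (g *\<^sub>R e)) (g *\<^sub>R e) (g *\<^sub>R e))"
        using ray_second_order[OF \<open>0 < s\<close> inS] by blast
      have "k (of_real g) = g *\<^sub>R e" "of_real g \<noteq> (0::complex)"
        using g by (auto simp: k_def)
      then have "0 < u'' (x + s2 *\<^sub>R (g *\<^sub>R e)) (g *\<^sub>R e) (g *\<^sub>R e)"
        using pos_def[OF near[OF inN[of s2]], of "of_real g"] s that by simp
      then have "0 \<le> s * (u' x (g *\<^sub>R e) + s1 * u'' (x + s2 *\<^sub>R (g *\<^sub>R e)) (g *\<^sub>R e) (g *\<^sub>R e))"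
        using s \<open>0 < s\<close> g by (intro mult_nonneg_nonneg add_nonneg_nonneg) (auto simp: blinfun.scaleR_right)
      then show ?thesis using s by linarith
    qed simp
    let ?T = "(\<lambda>s. x + s *\<^sub>R (g *\<^sub>R e)) ` {0..L}"
    have "0 \<le> L" using gc by (simp add: L_def)
    have "connected ?T"
      by (intro connected_continuous_image continuous_intros) auto
    moreover have "x \<in> ?T"
      using \<open>0 \<le> L\<close> by (intro image_eqI[of _ _ 0]) auto
    moreover have "?T \<subseteq> {x \<in> N. u z < u x}"
      using inN up x by fastforce
    moreover have "x + L *\<^sub>R (g *\<^sub>R e) \<in> ?T \<inter> C"
    proof -
      have "(cmod (c + of_real (L * g)))\<^sup>2 = r\<^sup>2"
        unfolding norm_c using h by (simp add: L_def)
      then have "cmod (c + of_real (L * g)) = r"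
        by (rule power2_eq_imp_eq) (use r in simp_all)
      then have "z + k (c + of_real (L * g)) \<in> ?C0"
        by (intro imageI) (simp only: mem_sphere_0)
      then have "x + L *\<^sub>R (g *\<^sub>R e) \<in> C"
        unfolding C_def by (rule UN_I) (simp only: mem_ball shift)
      then show ?thesis
        using \<open>0 \<le> L\<close> by auto
    qed
    ultimately show "\<exists>T. connected T \<and> x \<in> T \<and> T \<subseteq> {x \<in> N. u z < u x} \<and> T \<inter> C \<noteq> {}"
      by blast
  qed
  moreover have "open N" "z \<in> N"
    using d r by (auto simp: N_def k_def intro!: bexI[of _ 0])
  moreover have "N \<subseteq> W"
    using near R(2) by blast
  moreover have "{x \<in> N. u z < u x} \<noteq> {}"
    using CN C_ne by blast
  ultimately show ?thesis by blast
qed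

lemma local_superlevel_connected:
  assumes "z \<in> W" "open W" "W \<subseteq> S"
    and "u'' z e e = 1" "u'' z f f = 1" "u'' z e f = 0"
  shows "\<exists>N. open N \<and> z \<in> N \<and> N \<subseteq> W \<and> connected {x \<in> N. u z < u x} \<and> {x \<in> N. u z < u x} \<noteq> {}"
proof (cases "u' z = 0")
  case True
  show ?thesis
    by (rule local_superlevel_connected_critical[OF assms(1-3) True assms(4-6)])
next
  case False
  have "\<exists>v. u' z v \<noteq> 0"
  proof (rule ccontr)
    assume "\<nexists>v. u' z v \<noteq> 0"
    then have "u' z = 0" by (intro blinfun_eqI) simp
    with False show False by simp
  qed
  then obtain v where "u' z v \<noteq> 0" by blast
  then have "0 < u' z v \<or> 0 < u' z (- v)"
    by (auto simp: blinfun.minus_right)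
  then show ?thesis
    using local_superlevel_connected_regular[OF assms(1-3)] by blast
qed

end

section \<open>Global connectedness of superlevel sets\<close>

lemma compactin_attains:
  fixes \<phi> :: "'a \<Rightarrow> real"
  assumes "compactin X S" "continuous_map X euclideanreal \<phi>" "S \<noteq> {}"
  shows compactin_attains_sup: "\<exists>x\<in>S. \<forall>y\<in>S. \<phi> y \<le> \<phi> x"
    and compactin_attains_inf: "\<exists>x\<in>S. \<forall>y\<in>S. \<phi> x \<le> \<phi> y"
proof -
  have "compact (\<phi> ` S)"
    using image_compactin[OF assms(1,2)] by simp
  then show "\<exists>x\<in>S. \<forall>y\<in>S. \<phi> y \<le> \<phi> x" "\<exists>x\<in>S. \<forall>y\<in>S. \<phi> x \<le> \<phi> y"
    using compact_attains_sup[of "\<phi> ` S"] compact_attains_inf[of "\<phi> ` S"] assms(3) by auto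
qed

lemma path_component_of_imp_continuum:
  assumes "path_component_of X a b"
  obtains S where "compactin X S" "connectedin X S" "a \<in> S" "b \<in> S"
proof -
  obtain g where g: "pathin X g" "g 0 = a" "g 1 = b"
    using assms by (auto simp: path_component_of_def)
  then have cont: "continuous_map (top_of_set {0..1}) X g"
    by (simp add: pathin_def)
  show ?thesis
  proof (rule that[of "g ` {0..1}"])
    show "compactin X (g ` {0..1})"
      by (rule image_compactin[OF _ cont]) (simp add: compactin_subtopology)
    show "connectedin X (g ` {0..1})"
      by (rule connectedin_continuous_map_image[OF cont]) (simp add: connectedin_subtopology)
    show "a \<in> g ` {0..1}" "b \<in> g ` {0..1}"
      using g by force+
  qed
qed

text \<open>Downward propagation of a separation of \<open>{\<phi> > t}\<close>: by the local hypothesis the two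
  parts have disjoint closures on the compact level set \<open>{\<phi> = t}\<close>.\<close>

lemma separation_extends:
  fixes \<phi> :: "'a \<Rightarrow> real"
  assumes Y: "Hausdorff_space Y" and cont: "continuous_map Y euclideanreal \<phi>"
    and comp: "\<And>c. compactin Y {x \<in> topspace Y. \<phi> x \<le> c}"
    and loc: "\<And>p W. p \<in> W \<Longrightarrow> openin Y W \<Longrightarrow> \<exists>N. openin Y N \<and> p \<in> N \<and> N \<subseteq> W \<and>
      connectedin Y {x \<in> N. \<phi> p < \<phi> x} \<and> {x \<in> N. \<phi> p < \<phi> x} \<noteq> {}"
    and AB: "openin Y A" "openin Y B" "A \<inter> B = {}" "A \<union> B = {x \<in> topspace Y. t < \<phi> x}"
  obtains s M M' where "s < t" "openin Y M" "openin Y M'" "M \<inter> M' = {}" "A \<subseteq> M" "B \<subseteq> M'"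
    "{x \<in> topspace Y. s < \<phi> x} \<subseteq> M \<union> M'"
proof -
  define L where "L = {x \<in> topspace Y. \<phi> x = t}"
  \<comment> \<open>\<open>OA\<close> is the complement of the closure of \<open>B\<close>, and
    \<open>OB\<close> that of \<open>A\<close>. It is shown that each point of the level set
    \<open>L\<close> lies in exactly one of them.\<close>
  define OA where "OA = \<Union>{N. openin Y N \<and> N \<inter> B = {}}"
  define OB where "OB = \<Union>{N. openin Y N \<and> N \<inter> A = {}}"
  have open_O: "openin Y OA" "openin Y OB"
    by (auto simp: OA_def OB_def)
  have O_disj: "OA \<inter> B = {}" "OB \<inter> A = {}"
    by (auto simp: OA_def OB_def)
  \<comment> \<open>The connected piece of \<open>{\<phi> > t}\<close> near \<open>p\<close> lies in
    \<open>A\<close> or in \<open>B\<close>, so a neighbourhood of \<open>p\<close> misses the other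
    part.\<close>
  have L_cover: "p \<in> OA \<union> OB" if p: "p \<in> L" for p
  proof -
    obtain N where N: "openin Y N" "p \<in> N" "connectedin Y {x \<in> N. t < \<phi> x}"
      using loc[of p "topspace Y"] p by (auto simp: L_def)
    have "{x \<in> N. t < \<phi> x} \<subseteq> A \<union> B"
      unfolding AB(4) using openin_subset[OF N(1)] by auto
    then have "A \<inter> {x \<in> N. t < \<phi> x} = {} \<or> B \<inter> {x \<in> N. t < \<phi> x} = {}"
      using connectedinD[OF N(3) AB(1,2)] AB(3) by blast
    moreover have "A \<subseteq> {x. t < \<phi> x}" "B \<subseteq> {x. t < \<phi> x}"
      using AB(4) by auto
    ultimately have "N \<inter> A = {} \<or> N \<inter> B = {}" by blast
    then show ?thesis
      unfolding OA_def OB_def using N by blast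
  qed
  \<comment> \<open>Arbitrarily close to \<open>p\<close> there are points above level
    \<open>t\<close>, which belong to \<open>A\<close> or \<open>B\<close>; thus \<open>p\<close>
    cannot be away from both.\<close>
  have L_disj: "p \<notin> OA \<inter> OB" if p: "p \<in> L" for p
  proof
    assume "p \<in> OA \<inter> OB"
    then obtain N where N: "N \<subseteq> OA \<inter> OB" "{x \<in> N. t < \<phi> x} \<noteq> {}" "openin Y N"
      using loc[of p "OA \<inter> OB"] p open_O by (auto simp: L_def)
    then obtain x where "x \<in> N" "t < \<phi> x" by blast
    then have "x \<in> A \<union> B"
      unfolding AB(4) using openin_subset[OF N(3)] by auto
    then show False
      using \<open>x \<in> N\<close> N(1) O_disj by blast
  qed
  have open_less: "openin Y {x \<in> topspace Y. c < \<phi> x}" "openin Y {x \<in> topspace Y. \<phi> x < c}" for c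
    using openin_continuous_map_preimage[OF cont, of "{c<..}"]
      openin_continuous_map_preimage[OF cont, of "{..<c}"] by auto
  have compact_diff: "compactin Y ({x \<in> topspace Y. \<phi> x \<le> t} - D)" if "openin Y D" for D
  proof (rule closed_compactin[OF comp[of t]])
    show "closedin Y ({x \<in> topspace Y. \<phi> x \<le> t} - D)"
      using compactin_imp_closedin[OF Y comp[of t]] that by (rule closedin_diff)
  qed auto
  have "L - OB = {x \<in> topspace Y. \<phi> x \<le> t} - ({x \<in> topspace Y. \<phi> x < t} \<union> OB)"
    "L - OA = {x \<in> topspace Y. \<phi> x \<le> t} - ({x \<in> topspace Y. \<phi> x < t} \<union> OA)"
    by (auto simp: L_def)
  then have "compactin Y (L - OB)" "compactin Y (L - OA)"
    by (simp_all only:) (intro compact_diff openin_Un open_less open_O)+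
  moreover have "disjnt (L - OB) (L - OA)"
    using L_cover by (auto simp: disjnt_iff)
  ultimately obtain U V where UV: "openin Y U" "openin Y V" "L - OB \<subseteq> U" "L - OA \<subseteq> V" "disjnt U V"
    using Y unfolding Hausdorff_space_compact_sets by meson
  \<comment> \<open>\<open>U\<close> may meet \<open>B\<close>; cutting it down to \<open>OA\<close>
    keeps \<open>M\<close> disjoint from \<open>B\<close>, and likewise for \<open>M'\<close> and
    \<open>A\<close>.\<close>
  define M where "M = A \<union> (U \<inter> OA)"
  define M' where "M' = B \<union> (V \<inter> OB)"
  have M: "openin Y M" "openin Y M'" "M \<inter> M' = {}"
    using AB UV open_O O_disj by (auto simp: M_def M'_def disjnt_iff)
  have "L \<subseteq> M \<union> M'"
    using UV(3,4) L_cover L_disj by (auto simp: M_def M'_def)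
  \<comment> \<open>The uncovered points up to level \<open>t\<close> form a compact set that avoids
    the level \<open>t\<close> itself. Hence the maximum of \<open>\<phi>\<close> on it, if it is
    nonempty, is below \<open>t\<close> and serves as \<open>s\<close>.\<close>
  define Q where "Q = {x \<in> topspace Y. \<phi> x \<le> t} - (M \<union> M')"
  have Q_less: "\<phi> x < t" if "x \<in> Q" for x
    using that \<open>L \<subseteq> M \<union> M'\<close> by (force simp: L_def Q_def)
  have "compactin Y Q"
    unfolding Q_def by (intro compact_diff openin_Un M)
  have "\<exists>s<t. \<forall>x\<in>Q. \<phi> x \<le> s"
  proof (cases "Q = {}")
    case True
    then show ?thesis by (intro exI[of _ "t - 1"]) simp
  next
    case False
    then show ?thesis
      using compactin_attains_sup[OF \<open>compactin Y Q\<close> cont] Q_less by blast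
  qed
  then obtain s where s: "s < t" "\<And>x. x \<in> Q \<Longrightarrow> \<phi> x \<le> s"
    by blast
  have "{x \<in> topspace Y. s < \<phi> x} \<subseteq> M \<union> M'"
  proof
    fix x assume x: "x \<in> {x \<in> topspace Y. s < \<phi> x}"
    show "x \<in> M \<union> M'"
    proof (cases "t < \<phi> x")
      case True
      then have "x \<in> A \<union> B" unfolding AB(4) using x by auto
      then show ?thesis by (auto simp: M_def M'_def)
    next
      case False
      then show ?thesis using s(2)[of x] x by (force simp: Q_def)
    qed
  qed
  then show ?thesis
    using that[OF s(1) M] by (auto simp: M_def M'_def)
qed

text \<open>For two points \<open>a\<close> and \<open>b\<close> consider the supremum
  \<open>t\<close> of the levels above which they are joined. If \<open>t \<le> c\<close>, they are
  separated above \<open>t\<close> but joined above every lower level, contradicting the downward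
  extension of the separation.\<close>

lemma superlevel_connected:
  fixes \<phi> :: "'a \<Rightarrow> real"
  assumes Y: "Hausdorff_space Y" "connected_space Y" "locally_path_connected_space Y"
    and cont: "continuous_map Y euclideanreal \<phi>"
    and comp: "\<And>c. compactin Y {x \<in> topspace Y. \<phi> x \<le> c}"
    and loc: "\<And>p W. p \<in> W \<Longrightarrow> openin Y W \<Longrightarrow> \<exists>N. openin Y N \<and> p \<in> N \<and> N \<subseteq> W \<and>
      connectedin Y {x \<in> N. \<phi> p < \<phi> x} \<and> {x \<in> N. \<phi> p < \<phi> x} \<noteq> {}"
  shows "connectedin Y {x \<in> topspace Y. c < \<phi> x}"
proof -
  have "\<exists>S. connectedin Y S \<and> a \<in> S \<and> b \<in> S \<and> S \<subseteq> {x. c < \<phi> x}"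
    if ab: "a \<in> topspace Y" "b \<in> topspace Y" "c < \<phi> a" "c < \<phi> b" for a b
  proof (rule ccontr)
    assume no: "\<not> ?thesis"
    \<comment> \<open>Compactness of the joining set makes \<open>\<phi>\<close> attain its minimum
      there, strictly above the level, so the level can be raised a little. Therefore
      \<open>J\<close> does not contain its supremum.\<close>
    define J where "J = {t. \<exists>S. compactin Y S \<and> connectedin Y S \<and> a \<in> S \<and> b \<in> S \<and> S \<subseteq> {x. t < \<phi> x}}"
    have J_down: "s \<in> J" if "t \<in> J" "s \<le> t" for s t
    proof -
      have "{x. t < \<phi> x} \<subseteq> {x. s < \<phi> x}" using that by auto
      then show ?thesis using that(1) unfolding J_def by blast
    qed
    have J_up: "\<exists>s\<in>J. t < s" if "t \<in> J" for t
    proof -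
      obtain S where S: "compactin Y S" "connectedin Y S" "a \<in> S" "b \<in> S" "S \<subseteq> {x. t < \<phi> x}"
        using \<open>t \<in> J\<close> unfolding J_def by blast
      obtain x0 where x0: "x0 \<in> S" "\<And>x. x \<in> S \<Longrightarrow> \<phi> x0 \<le> \<phi> x"
        using compactin_attains_inf[OF S(1) cont] S(3) by blast
      have "t < \<phi> x0" using x0(1) S(5) by auto
      then obtain s where s: "t < s" "s < \<phi> x0" using dense by blast
      then have "S \<subseteq> {x. s < \<phi> x}" using x0(2) by force
      then have "s \<in> J" unfolding J_def using S by blast
      with s(1) show ?thesis by blast
    qed
    have "J \<noteq> {}"
    proof -
      have "path_connected_space Y"
        using Y path_connected_eq_connected_space by blast
      then have "path_component_of Y a b"
        using ab by (simp add: path_connected_space_def path_component_of_def)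
      then obtain S where S: "compactin Y S" "connectedin Y S" "a \<in> S" "b \<in> S"
        by (rule path_component_of_imp_continuum)
      obtain x0 where x0: "x0 \<in> S" "\<And>x. x \<in> S \<Longrightarrow> \<phi> x0 \<le> \<phi> x"
        using compactin_attains_inf[OF S(1) cont] S(3) by blast
      then have "S \<subseteq> {x. \<phi> x0 - 1 < \<phi> x}" by force
      then have "\<phi> x0 - 1 \<in> J" unfolding J_def using S by blast
      then show ?thesis by blast
    qed
    have J_le: "t \<le> c" if "t \<in> J" for t
    proof (rule ccontr)
      assume "\<not> t \<le> c"
      then have "c \<in> J" using J_down[OF that, of c] by simp
      then show False using no unfolding J_def by blast
    qed
    define t where "t = Sup J"
    have bdd: "bdd_above J" using J_le by (auto simp: bdd_above_def)
    have t_le: "t \<le> c"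
      unfolding t_def using \<open>J \<noteq> {}\<close> J_le by (rule cSup_least)
    have below: "s \<in> J" if "s < t" for s
      using that less_cSup_iff[OF \<open>J \<noteq> {}\<close> bdd] J_down unfolding t_def by (meson less_imp_le)
    have "t \<notin> J"
      using J_up cSup_upper[OF _ bdd] unfolding t_def by fastforce
    define G where "G = {x \<in> topspace Y. t < \<phi> x}"
    \<comment> \<open>Local path connectedness makes this path component open and closed in
      \<open>G\<close>, which yields an honest separation; \<open>b \<in> A\<close> would give a
      compact path above \<open>t\<close> and put \<open>t\<close> into \<open>J\<close>.\<close>
    define A where "A = {x. path_component_of (subtopology Y G) a x}"
    have openG: "openin Y G"
      unfolding G_def using openin_continuous_map_preimage[OF cont, of "{t<..}"] by auto
    then have lpc: "locally_path_connected_space (subtopology Y G)"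
      using Y(3) by (rule locally_path_connected_space_open_subset[rotated])
    have aG: "a \<in> G" "b \<in> G" using ab t_le by (auto simp: G_def)
    have topG: "topspace (subtopology Y G) = G"
      by (auto simp: G_def)
    have A_G: "A \<subseteq> G"
      using path_component_of_subset_topspace[of "subtopology Y G" a] unfolding A_def topG .
    have openA: "openin Y A"
      using openin_path_component_of_locally_path_connected_space[OF lpc, of a] openG
      unfolding A_def by (metis openin_open_subtopology)
    have "closedin (subtopology Y G) A"
      unfolding A_def by (rule closedin_path_component_of_locally_path_connected_space[OF lpc])
    then have "openin (subtopology Y G) (G - A)"
      unfolding closedin_def topG by simp
    then have openB: "openin Y (G - A)"
      using openG by (metis openin_open_subtopology)
    have "a \<in> A"
      unfolding A_def using aG topG by (simp add: path_component_of_refl)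
    have "b \<notin> A"
    proof
      assume "b \<in> A"
      then obtain S where S: "compactin (subtopology Y G) S" "connectedin (subtopology Y G) S" "a \<in> S" "b \<in> S"
        unfolding A_def by (auto elim: path_component_of_imp_continuum)
      then have "t \<in> J"
        unfolding J_def by (auto simp: compactin_subtopology connectedin_subtopology G_def intro!: exI[of _ S])
      with \<open>t \<notin> J\<close> show False ..
    qed
    have "A \<inter> (G - A) = {}" "A \<union> (G - A) = {x \<in> topspace Y. t < \<phi> x}"
      using A_G by (auto simp: G_def)
    then obtain s M M' where M: "s < t" "openin Y M" "openin Y M'" "M \<inter> M' = {}" "A \<subseteq> M" "G - A \<subseteq> M'"
      "{x \<in> topspace Y. s < \<phi> x} \<subseteq> M \<union> M'"
      using separation_extends[OF Y(1) cont comp loc openA openB] by blast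
    obtain S where S: "connectedin Y S" "a \<in> S" "b \<in> S" "S \<subseteq> {x. s < \<phi> x}"
      using below[OF M(1)] unfolding J_def by blast
    have "S \<subseteq> M \<union> M'"
      using M(7) S(4) connectedin_subset_topspace[OF S(1)] by blast
    then show False
      using connectedinD[OF S(1) M(2,3)] M(4-6) S(2,3) \<open>a \<in> A\<close> \<open>b \<notin> A\<close> aG by blast
  qed
  note joined = this
  define G where "G = {x \<in> topspace Y. c < \<phi> x}"
  have "connectedin Y G"
  proof (rule ccontr)
    assume "\<not> connectedin Y G"
    moreover have "G \<subseteq> topspace Y" by (auto simp: G_def)
    ultimately obtain E1 E2 where E: "openin Y E1" "openin Y E2" "G \<subseteq> E1 \<union> E2" "E1 \<inter> E2 \<inter> G = {}"
      "E1 \<inter> G \<noteq> {}" "E2 \<inter> G \<noteq> {}"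
      unfolding connectedin by blast
    obtain a b where ab: "a \<in> E1" "a \<in> G" "b \<in> E2" "b \<in> G"
      using E(5,6) by blast
    then obtain S where S: "connectedin Y S" "a \<in> S" "b \<in> S" "S \<subseteq> {x. c < \<phi> x}"
      using joined[of a b] by (auto simp: G_def)
    then have "S \<subseteq> G"
      using connectedin_subset_topspace[OF S(1)] by (auto simp: G_def)
    then show False
      using connectedinD[OF S(1) E(1,2)] E(3,4) S(2,3) ab(1,3) by blast
  qed
  then show ?thesis by (simp add: G_def)
qed

section \<open>From superlevel sets to the boundary\<close>

lemma connectedin_frontier_of:
  fixes \<phi> :: "'a \<Rightarrow> real"
  assumes X: "Hausdorff_space X" and \<Omega>: "openin X \<Omega>" "compactin X (X closure_of \<Omega>)"
    and cont: "continuous_map (subtopology X \<Omega>) euclideanreal \<phi>"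
    and comp: "\<And>c. compactin X {x \<in> \<Omega>. \<phi> x \<le> c}"
    and conn: "\<And>c. connectedin X {x \<in> \<Omega>. c < \<phi> x}"
  shows "connectedin X (X frontier_of \<Omega>)"
proof (rule ccontr)
  assume no: "\<not> ?thesis"
  let ?F = "X frontier_of \<Omega>"
  have F: "?F = X closure_of \<Omega> - \<Omega>"
    using \<Omega>(1) by (simp add: frontier_of_def interior_of_openin)
  obtain E1 E2 where E: "closedin X E1" "closedin X E2" "?F \<subseteq> E1 \<union> E2" "E1 \<inter> E2 \<inter> ?F = {}"
      "E1 \<inter> ?F \<noteq> {}" "E2 \<inter> ?F \<noteq> {}"
    using no frontier_of_subset_topspace[of X \<Omega>] unfolding connectedin_closedin by blast
  \<comment> \<open>Relative compactness makes the two pieces of the frontier compact, so the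
    Hausdorff property gives them disjoint open neighbourhoods.\<close>
  have "compactin X (E \<inter> ?F)" if "closedin X E" for E
  proof (rule closed_compactin[OF \<Omega>(2)])
    show "closedin X (E \<inter> ?F)"
      using that by (intro closedin_Int closedin_frontier_of)
  qed (use F in auto)
  then have "compactin X (E1 \<inter> ?F)" "compactin X (E2 \<inter> ?F)" "disjnt (E1 \<inter> ?F) (E2 \<inter> ?F)"
    using E by (auto simp: disjnt_iff)
  then obtain U V where UV: "openin X U" "openin X V" "E1 \<inter> ?F \<subseteq> U" "E2 \<inter> ?F \<subseteq> V" "disjnt U V"
    using X unfolding Hausdorff_space_compact_sets by meson
  \<comment> \<open>\<open>K\<close> is compact and misses the frontier, so it lies inside
    \<open>\<Omega>\<close> and \<open>\<phi>\<close> is bounded on it; above that bound only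
    \<open>U\<close> and \<open>V\<close> remain.\<close>
  define K where "K = X closure_of \<Omega> - (U \<union> V)"
  have "compactin X K"
    unfolding K_def using UV
    by (intro closed_compactin[OF \<Omega>(2)] closedin_diff closedin_closure_of openin_Un) auto
  moreover have "K \<subseteq> \<Omega>"
    using E(3) UV(3,4) F by (auto simp: K_def)
  ultimately have "compactin (subtopology X \<Omega>) K"
    by (simp add: compactin_subtopology)
  from compactin_attains_sup[OF this cont] obtain c where c: "\<And>x. x \<in> K \<Longrightarrow> \<phi> x \<le> c"
    by (cases "K = {}") auto
  \<comment> \<open>The sublevel set is compact, hence closed in \<open>X\<close>, and contains no
    frontier point. Removing it from \<open>W\<close> leaves a neighbourhood of \<open>x\<close>,
    which still meets \<open>\<Omega>\<close>.\<close>
  have reach: "\<exists>a\<in>\<Omega> \<inter> W. c < \<phi> a" if W: "openin X W" "x \<in> W" "x \<in> ?F" for W x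
  proof -
    have "closedin X {x \<in> \<Omega>. \<phi> x \<le> c}"
      using X comp by (rule compactin_imp_closedin)
    then have "openin X (W - {x \<in> \<Omega>. \<phi> x \<le> c})"
      using W(1) by (rule openin_diff[rotated])
    moreover have "x \<in> W - {x \<in> \<Omega>. \<phi> x \<le> c}"
      using W F by auto
    moreover have "x \<in> X closure_of \<Omega>"
      using W F by auto
    then have "\<exists>y. y \<in> \<Omega> \<and> y \<in> T" if "x \<in> T" "openin X T" for T
      using that by (simp add: in_closure_of)
    ultimately obtain a where "a \<in> \<Omega>" "a \<in> W - {x \<in> \<Omega>. \<phi> x \<le> c}"
      by meson
    then show ?thesis by (intro bexI[of _ a]) auto
  qed
  obtain a where a: "a \<in> \<Omega>" "a \<in> U" "c < \<phi> a"
    using reach[OF UV(1)] E(5) UV(3) by blast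
  obtain b where b: "b \<in> \<Omega>" "b \<in> V" "c < \<phi> b"
    using reach[OF UV(2)] E(6) UV(4) by blast
  have "{x \<in> \<Omega>. c < \<phi> x} \<subseteq> U \<union> V"
  proof
    fix x assume x: "x \<in> {x \<in> \<Omega>. c < \<phi> x}"
    then have "x \<in> X closure_of \<Omega>"
      using closure_of_subset[OF openin_subset[OF \<Omega>(1)]] by blast
    with x c[of x] show "x \<in> U \<union> V"
      by (auto simp: K_def)
  qed
  moreover have "U \<inter> V \<inter> {x \<in> \<Omega>. c < \<phi> x} = {}"
    using UV(5) by (simp add: disjnt_def)
  moreover have "a \<in> U \<inter> {x \<in> \<Omega>. c < \<phi> x}" "b \<in> V \<inter> {x \<in> \<Omega>. c < \<phi> x}"
    using a b by simp_all
  ultimately show False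
    using connectedinD[OF conn[of c] UV(1,2)] by blast
qed

section \<open>Complex manifolds\<close>

lemma is_chartD:
  assumes "is_chart X (U, f)"
  shows "openin X U" "open (f ` U)" "homeomorphic_map (subtopology X U) (top_of_set (f ` U)) f"
    "topspace (subtopology X U) = U" "inj_on f U"
proof -
  show *: "openin X U" "open (f ` U)" "homeomorphic_map (subtopology X U) (top_of_set (f ` U)) f"
    using assms by (simp_all add: is_chart_def)
  show top: "topspace (subtopology X U) = U"
    using openin_subset[OF *(1)] by auto
  show "inj_on f U"
    using homeomorphic_imp_injective_map[OF *(3)] top by simp
qed

lemma chart_open_image:
  assumes "is_chart X (U, f)" "openin X W"
  shows "open (f ` (U \<inter> W))"
proof -
  note c = is_chartD[OF assms(1)]
  have "openin (subtopology X U) (U \<inter> W)"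
    using c(1) assms(2) by (simp add: openin_open_subtopology openin_Int)
  then have "openin (top_of_set (f ` U)) (f ` (U \<inter> W))"
    using homeomorphic_map_openness[OF c(3), of "U \<inter> W", unfolded c(4)] by simp
  then show ?thesis
    using c(2) by (simp add: openin_open_eq)
qed

lemma chart_neighbourhood:
  assumes "is_chart X (U, f)" and N: "open N" "N \<subseteq> f ` (U \<inter> W)"
  obtains N' where "openin X N'" "N' \<subseteq> U \<inter> W" "N' = {x \<in> U. f x \<in> N}" "f ` N' = N"
proof (rule that[OF _ _ refl])
  note c = is_chartD[OF assms(1)]
  have "openin (subtopology X U) {x \<in> topspace (subtopology X U). f x \<in> N}"
    using homeomorphic_imp_continuous_map[OF c(3)] N
    by (intro openin_continuous_map_preimage[of _ euclidean]) (auto dest: continuous_map_into_fulltopology)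
  then have "openin (subtopology X U) {x \<in> U. f x \<in> N}"
    unfolding c(4) .
  then show "openin X {x \<in> U. f x \<in> N}"
    using c(1) by (simp add: openin_open_subtopology)
  show "{x \<in> U. f x \<in> N} \<subseteq> U \<inter> W"
    using N(2) c(5) by (auto dest: inj_onD)
  show "f ` {x \<in> U. f x \<in> N} = N"
    using N(2) by auto
qed

lemma connectedin_chart:
  assumes "is_chart X (U, f)" "S \<subseteq> U" "connected (f ` S)"
  shows "connectedin X S"
proof -
  note c = is_chartD[OF assms(1)]
  have "connectedin (top_of_set (f ` U)) (f ` S)"
    using assms(2,3) by (auto simp: connectedin_subtopology)
  then have "connectedin (subtopology X U) S"
    using homeomorphic_map_connectedness[OF c(3), of S, unfolded c(4)] assms(2) by simp
  then show ?thesis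
    by (simp add: connectedin_subtopology)
qed

lemma path_connectedin_chart:
  assumes "is_chart X (U, f)" "S \<subseteq> U" "path_connected (f ` S)"
  shows "path_connectedin X S"
proof -
  note c = is_chartD[OF assms(1)]
  have "path_connectedin (top_of_set (f ` U)) (f ` S)"
    using assms(2,3) by (auto simp: path_connectedin_subtopology)
  then have "path_connectedin (subtopology X U) S"
    using homeomorphic_map_path_connectedness[OF c(3), of S, unfolded c(4)] assms(2) by simp
  then show ?thesis
    by (simp add: path_connectedin_subtopology)
qed

lemma complex_manifold_chart:
  assumes "complex_manifold X \<A>" "x \<in> topspace X"
  obtains U f where "(U, f) \<in> \<A>" "is_chart X (U, f)" "x \<in> U"
proof -
  have "x \<in> (\<Union>(U, f)\<in>\<A>. U)" and charts: "\<forall>c\<in>\<A>. is_chart X c"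
    using assms by (simp_all add: complex_manifold_def)
  then obtain U f where "(U, f) \<in> \<A>" "x \<in> U" by auto
  then show ?thesis using that charts by blast
qed

text \<open>Coordinate balls form the required neighbourhoods. This provides paths in the connected
  set \<open>\<Omega>\<close> and makes path components of superlevel sets open.\<close>

lemma locally_path_connected_complex_manifold:
  assumes "complex_manifold X \<A>"
  shows "locally_path_connected_space X"
  unfolding locally_path_connected_space
proof (intro allI impI, elim conjE)
  fix V x assume V: "openin X V" "x \<in> V"
  then have "x \<in> topspace X"
    using openin_subset by blast
  then obtain U f where "(U, f) \<in> \<A>" and c: "is_chart X (U, f)" "x \<in> U"
    by (rule complex_manifold_chart[OF assms])
  have "f x \<in> f ` (U \<inter> V)" using c V by auto
  then obtain e where e: "0 < e" "ball (f x) e \<subseteq> f ` (U \<inter> V)"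
    using chart_open_image[OF c(1) V(1)] open_contains_ball by blast
  obtain N where N: "openin X N" "N \<subseteq> U \<inter> V" "N = {y \<in> U. f y \<in> ball (f x) e}" "f ` N = ball (f x) e"
    using chart_neighbourhood[OF c(1) open_ball e(2)] by blast
  have "path_connectedin X N"
    using N by (intro path_connectedin_chart[OF c(1)]) (auto simp: convex_imp_path_connected)
  then show "\<exists>U. openin X U \<and> path_connectedin X U \<and> x \<in> U \<and> U \<subseteq> V"
    using N c(2) e(1) by (intro exI[of _ N]) auto
qed

lemma C2_smooth_on_chart:
  assumes "C2_smooth_on \<A> \<Omega> \<phi>" "(U, f) \<in> \<A>" "is_chart X (U, f)" "openin X \<Omega>"
  obtains u' u'' where "C2_fun (f ` (U \<inter> \<Omega>)) (\<phi> \<circ> inv_into U f) u' u''"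
proof -
  have "C2_on (\<phi> \<circ> inv_into U f) (f ` (U \<inter> \<Omega>))"
    using assms(1,2) by (auto simp: C2_smooth_on_def)
  then show ?thesis
    using chart_open_image[OF assms(3,4)] that unfolding C2_on_def C2_fun_def by blast
qed

lemma C2_smooth_on_imp_continuous_map:
  assumes X: "complex_manifold X \<A>" and \<Omega>: "openin X \<Omega>" and \<phi>: "C2_smooth_on \<A> \<Omega> \<phi>"
  shows "continuous_map (subtopology X \<Omega>) euclideanreal \<phi>"
proof -
  have top: "topspace (subtopology X \<Omega>) = \<Omega>"
    using openin_subset[OF \<Omega>] by auto
  have "openin (subtopology X \<Omega>) {x \<in> \<Omega>. \<phi> x \<in> T}" if "open T" for T
  proof (subst openin_subopen, rule ballI)
    fix x assume x: "x \<in> {x \<in> \<Omega>. \<phi> x \<in> T}"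
    then have "x \<in> topspace X"
      using openin_subset[OF \<Omega>] by blast
    then obtain U f where c: "(U, f) \<in> \<A>" "is_chart X (U, f)" "x \<in> U"
      by (rule complex_manifold_chart[OF X])
    define u where "u = \<phi> \<circ> inv_into U f"
    have u: "u (f y) = \<phi> y" if "y \<in> U" for y
      using that is_chartD(5)[OF c(2)] by (simp add: u_def)
    obtain u' u'' where "C2_fun (f ` (U \<inter> \<Omega>)) u u' u''"
      using C2_smooth_on_chart[OF \<phi> c(1,2) \<Omega>] unfolding u_def by blast
    then interpret C2_fun "f ` (U \<inter> \<Omega>)" u u' u'' .
    define D where "D = f ` (U \<inter> \<Omega>) \<inter> u -` T"
    have "open D"
      unfolding D_def by (rule continuous_open_preimage[OF cont_u open_S that])
    moreover have "D \<subseteq> f ` (U \<inter> \<Omega>)"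
      by (simp add: D_def)
    ultimately obtain N where N: "openin X N" "N \<subseteq> U \<inter> \<Omega>" "N = {y \<in> U. f y \<in> D}" "f ` N = D"
      by (rule chart_neighbourhood[OF c(2)])
    have "\<phi> y \<in> T" if "y \<in> N" for y
    proof -
      have "y \<in> U" "f y \<in> D"
        using that N(3) by auto
      then show ?thesis
        using u[of y] by (simp add: D_def)
    qed
    moreover have "x \<in> N"
      using x c(3) u by (auto simp: N(3) D_def)
    ultimately show "\<exists>N. openin (subtopology X \<Omega>) N \<and> x \<in> N \<and> N \<subseteq> {x \<in> \<Omega>. \<phi> x \<in> T}"
      using N(1,2) by (intro exI[of _ N]) (auto simp: openin_open_subtopology[OF \<Omega>])
  qed
  then show ?thesis
    unfolding continuous_map top by simp
qed

section \<open>Application to \<open>q\<close>-complete domains\<close>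

lemma q_convex_local_superlevel_connected:
  fixes \<A> :: "('a, 'n::finite) chart set"
  assumes X: "complex_manifold X \<A>" and \<Omega>: "openin X \<Omega>"
    and \<phi>: "C2_smooth_on \<A> \<Omega> \<phi>" "q_convex_on \<A> q \<Omega> \<phi>" and q: "1 \<le> q" "q < CARD('n)"
    and W: "openin X W" "W \<subseteq> \<Omega>" "p \<in> W"
  shows "\<exists>N. openin X N \<and> p \<in> N \<and> N \<subseteq> W \<and>
    connectedin X {x \<in> N. \<phi> p < \<phi> x} \<and> {x \<in> N. \<phi> p < \<phi> x} \<noteq> {}"
proof -
  have "p \<in> topspace X"
    using openin_subset[OF W(1)] W(3) by blast
  then obtain U f where c: "(U, f) \<in> \<A>" "is_chart X (U, f)" "p \<in> U"
    by (rule complex_manifold_chart[OF X])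
  define u where "u = \<phi> \<circ> inv_into U f"
  have u: "u (f y) = \<phi> y" if "y \<in> U" for y
    using that is_chartD(5)[OF c(2)] by (simp add: u_def)
  obtain u' u'' where C2: "C2_fun (f ` (U \<inter> \<Omega>)) u u' u''"
    using C2_smooth_on_chart[OF \<phi>(1) c(1,2) \<Omega>] unfolding u_def by blast
  interpret C2_complex "f ` (U \<inter> \<Omega>)" u u' u''
    using C2 by (simp add: C2_complex_def)
  have fp: "f p \<in> f ` (U \<inter> W)" "f p \<in> f ` (U \<inter> \<Omega>)"
    using c(3) W by auto
  have "num_nonpos_eigenvalues (levi_matrix u (f p)) \<le> q - 1"
    using \<phi>(2) c(1,3) W unfolding q_convex_on_def u_def by blast
  \<comment> \<open>As \<open>1 \<le> q\<close>, the truncated difference \<open>q - 1\<close> is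
    the true one, and \<open>(q - 1) + 2 = q + 1 \<le> CARD('n)\<close>.\<close>
  then have "num_nonpos_eigenvalues (levi_matrix u (f p)) + 2 \<le> CARD('n)"
    using q by linarith
  then obtain e h where eh: "u'' (f p) e e = 1" "u'' (f p) h h = 1" "u'' (f p) e h = 0"
    using two_positive_directions[OF fp(2)] by blast
  have "f ` (U \<inter> W) \<subseteq> f ` (U \<inter> \<Omega>)"
    using W(2) by blast
  from local_superlevel_connected[OF fp(1) chart_open_image[OF c(2) W(1)] this eh]
  obtain N where N: "open N" "f p \<in> N" "N \<subseteq> f ` (U \<inter> W)"
    "connected {y \<in> N. u (f p) < u y}" "{y \<in> N. u (f p) < u y} \<noteq> {}"
    by (elim exE conjE) (rule that)
  obtain N' where N': "openin X N'" "N' \<subseteq> U \<inter> W" "N' = {x \<in> U. f x \<in> N}" "f ` N' = N"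
    using chart_neighbourhood[OF c(2) N(1,3)] by blast
  have image: "f ` {x \<in> N'. \<phi> p < \<phi> x} = {y \<in> N. u (f p) < u y}"
    using N'(2) u c(3) unfolding N'(4)[symmetric] by auto
  have "connectedin X {x \<in> N'. \<phi> p < \<phi> x}"
    using N'(2) N(4) image by (intro connectedin_chart[OF c(2)]) auto
  moreover have "{x \<in> N'. \<phi> p < \<phi> x} \<noteq> {}"
    using N(5) image by (metis image_empty)
  ultimately show ?thesis
    using N' N(2) c(3) by (intro exI[of _ N']) auto
qed

theorem theorem2:
  fixes X :: "'a topology"
    and \<A> :: "('a, 'n::finite) chart set"
    and q :: nat
    and \<Omega> :: "'a set"
  assumes "complex_manifold X \<A>"
    and "q \<ge> 1"
    and "domain_in X \<Omega>"
    and "relatively_compact_in X \<Omega>"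
    and "q_complete X \<A> q \<Omega>"
    and "CARD('n) > q"
  shows "connectedin X (X frontier_of \<Omega>)"
proof -
  have X: "Hausdorff_space X"
    using assms(1) by (simp add: complex_manifold_def)
  have \<Omega>: "openin X \<Omega>" "connectedin X \<Omega>"
    using assms(3) by (simp_all add: domain_in_def)
  obtain \<phi> where \<phi>: "C2_smooth_on \<A> \<Omega> \<phi>" "q_convex_on \<A> q \<Omega> \<phi>"
    and comp: "\<And>c. compactin X {x \<in> \<Omega>. \<phi> x \<le> c}"
    using assms(5) by (auto simp: q_complete_def exhaustion_function_def)
  \<comment> \<open>The global argument is carried out inside \<open>\<Omega>\<close>, since
    \<open>\<phi>\<close> is meaningful and continuous only there; its compact sublevel sets are the
    same in both topologies.\<close>
  define Y where "Y = subtopology X \<Omega>"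
  have top: "topspace Y = \<Omega>"
    using openin_subset[OF \<Omega>(1)] by (auto simp: Y_def)
  have cont: "continuous_map Y euclideanreal \<phi>"
    unfolding Y_def by (rule C2_smooth_on_imp_continuous_map[OF assms(1) \<Omega>(1) \<phi>(1)])
  have "connectedin Y {x \<in> topspace Y. c < \<phi> x}" for c
  proof (rule superlevel_connected[OF _ _ _ cont])
    show "Hausdorff_space Y" "connected_space Y" "locally_path_connected_space Y"
      using X \<Omega> locally_path_connected_complex_manifold[OF assms(1)]
      by (simp_all add: Y_def Hausdorff_space_subtopology connectedin_def
          locally_path_connected_space_open_subset)
    show "compactin Y {x \<in> topspace Y. \<phi> x \<le> c}" for c
      unfolding top using comp[of c] by (simp add: Y_def compactin_subtopology)
    show "\<exists>N. openin Y N \<and> p \<in> N \<and> N \<subseteq> W \<and>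
        connectedin Y {x \<in> N. \<phi> p < \<phi> x} \<and> {x \<in> N. \<phi> p < \<phi> x} \<noteq> {}"
      if p: "p \<in> W" and "openin Y W" for p W
    proof -
      have W: "openin X W" "W \<subseteq> \<Omega>"
        using that \<Omega>(1) by (simp_all add: Y_def openin_open_subtopology)
      obtain N where N: "openin X N" "p \<in> N" "N \<subseteq> W" "connectedin X {x \<in> N. \<phi> p < \<phi> x}"
        "{x \<in> N. \<phi> p < \<phi> x} \<noteq> {}"
        using q_convex_local_superlevel_connected[OF assms(1) \<Omega>(1) \<phi> assms(2,6) W p] by blast
      have "openin Y N" "connectedin Y {x \<in> N. \<phi> p < \<phi> x}"
        using N W \<Omega>(1) by (auto simp: Y_def openin_open_subtopology connectedin_subtopology)
      with N show ?thesis by blast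
    qed
  qed
  then have conn: "connectedin X {x \<in> \<Omega>. c < \<phi> x}" for c
    unfolding top by (simp add: Y_def connectedin_subtopology)
  show ?thesis
    using connectedin_frontier_of[OF X \<Omega>(1) _ _ comp conn] assms(4) cont
    by (simp add: relatively_compact_in_def Y_def)
qed

end
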